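(* Let $M=\mathbb{H}^3/\Gamma$ be an arithmetic hyperbolic 3-manifold. Then $\Gamma$ is commensurable with an arithmetic Kleinian group $\Gamma_0$ containing a subgroup isomorphic to $\mathbb{Z}/2\mathbb{Z}\times\mathbb{Z}/2\mathbb{Z}$.
   Context: Arithmetic Kleinian groups: let $k$ be a number field with exactly one complex place, $B$ a quaternion algebra over $k$ ramified at all real places of $k$, $\rho: B\to M(2,\mathbb{C})$ an embedding, $\mathcal{O}$ an order of $B$, and $\mathcal{O}^1$ its group of elements of norm one. Let $\mathrm{P}\rho(\mathcal{O}^1)$ be the image of $\rho(\mathcal{O}^1)$ in $\mathrm{PSL}(2,\mathbb{C})$. A subgroup of $\mathrm{PSL}(2,\mathbb{C})$ is an arithmetic Kleinian group if it is commensurable with some such $\mathrm{P}\rho(\mathcal{O}^1)$. A hyperbolic 3-manifold $\mathbb{H}^3/\Gamma$ ($\Gamma$ torsion-free) is arithmetic if $\Gamma$ is an arithmetic Kleinian group. Two subgroups of $\mathrm{PSL}(2,\mathbb{C})$ are commensurable if their intersection has finite index in both. *)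

theory Defs
  imports
    "HOL-Analysis.Analysis"
    "HOL-Algebra.Algebra"
    "HOL-Decision_Procs.Algebra_Aux"
begin

section \<open>Number fields\<close>

definition number_field :: "('a, 'm) ring_scheme \<Rightarrow> bool" where
  "number_field F \<longleftrightarrow> field F \<and>
     (\<exists>h \<in> ring_hom (cring_class_ops :: rat ring) F.
        ring.finite_dimension F (range h) (carrier F))"

text \<open>The algebraic integers of \<open>F\<close>: roots of monic polynomials with integer coefficients.\<close>

definition ring_of_integers :: "('a, 'm) ring_scheme \<Rightarrow> 'a set" where
  "ring_of_integers F =
     {x \<in> carrier F. \<exists>(n :: nat) (c :: nat \<Rightarrow> int).
        x [^]\<^bsub>F\<^esub> n \<oplus>\<^bsub>F\<^esub> (\<Oplus>\<^bsub>F\<^esub>m \<in> {..<n}. add_pow F (c m) (x [^]\<^bsub>F\<^esub> m)) = \<zero>\<^bsub>F\<^esub>}"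

definition real_embeddings :: "('a, 'm) ring_scheme \<Rightarrow> ('a \<Rightarrow> real) set" where
  "real_embeddings F = ring_hom F (cring_class_ops :: real ring)"

definition nonreal_embeddings :: "('a, 'm) ring_scheme \<Rightarrow> ('a \<Rightarrow> complex) set" where
  "nonreal_embeddings F =
     {\<sigma> \<in> ring_hom F (cring_class_ops :: complex ring). \<not> \<sigma> ` carrier F \<subseteq> \<real>}"

text \<open>A complex place is a pair of complex conjugate non-real embeddings. As HOL functions are
  total, embeddings are restricted to the carrier before they are counted.\<close>

definition complex_places :: "('a, 'm) ring_scheme \<Rightarrow> ('a \<Rightarrow> complex) set set" where
  "complex_places F =
     (\<lambda>\<sigma>. {restrict \<sigma> (carrier F), restrict (cnj \<circ> \<sigma>) (carrier F)}) ` nonreal_embeddings F"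


section \<open>Quaternion algebras\<close>

text \<open>A quaternion algebra over a field \<open>K\<close> (of characteristic different from 2) is a ring \<open>B\<close>
  containing \<open>K\<close> as a central subfield, with a \<open>K\<close>-basis \<open>1, i, j, ij\<close> such that
  \<open>i\<^sup>2, j\<^sup>2 \<in> K - {0}\<close> and \<open>ij = -ji\<close>.\<close>

definition quaternion_basis :: "'b set \<Rightarrow> ('b, 'm) ring_scheme \<Rightarrow> 'b \<Rightarrow> 'b \<Rightarrow> bool" where
  "quaternion_basis K B i j \<longleftrightarrow>
     i \<in> carrier B \<and> j \<in> carrier B \<and>
     i \<otimes>\<^bsub>B\<^esub> i \<in> K - {\<zero>\<^bsub>B\<^esub>} \<and> j \<otimes>\<^bsub>B\<^esub> j \<in> K - {\<zero>\<^bsub>B\<^esub>} \<and>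
     i \<otimes>\<^bsub>B\<^esub> j = \<ominus>\<^bsub>B\<^esub> (j \<otimes>\<^bsub>B\<^esub> i) \<and>
     ring.independent B K [\<one>\<^bsub>B\<^esub>, i, j, i \<otimes>\<^bsub>B\<^esub> j] \<and>
     ring.Span B K [\<one>\<^bsub>B\<^esub>, i, j, i \<otimes>\<^bsub>B\<^esub> j] = carrier B"

definition quaternion_algebra :: "'b set \<Rightarrow> ('b, 'm) ring_scheme \<Rightarrow> bool" where
  "quaternion_algebra K B \<longleftrightarrow>
     ring B \<and> subfield K B \<and>
     (\<forall>c \<in> K. \<forall>x \<in> carrier B. c \<otimes>\<^bsub>B\<^esub> x = x \<otimes>\<^bsub>B\<^esub> c) \<and>
     (\<exists>i j. quaternion_basis K B i j)"

text \<open>The conjugate of \<open>x0 + x1 i + x2 j + x3 ij\<close> is \<open>x0 - x1 i - x2 j - x3 ij\<close>; it does not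
  depend on the choice of the quaternion basis.\<close>

definition quat_conj :: "'b set \<Rightarrow> ('b, 'm) ring_scheme \<Rightarrow> 'b \<Rightarrow> 'b" where
  "quat_conj K B x =
     (THE y. \<exists>i j. quaternion_basis K B i j \<and>
        (\<exists>x0 \<in> K. \<exists>x1 \<in> K. \<exists>x2 \<in> K. \<exists>x3 \<in> K.
           x = x0 \<oplus>\<^bsub>B\<^esub> x1 \<otimes>\<^bsub>B\<^esub> i \<oplus>\<^bsub>B\<^esub> x2 \<otimes>\<^bsub>B\<^esub> j \<oplus>\<^bsub>B\<^esub> x3 \<otimes>\<^bsub>B\<^esub> (i \<otimes>\<^bsub>B\<^esub> j) \<and>
           y = x0 \<ominus>\<^bsub>B\<^esub> x1 \<otimes>\<^bsub>B\<^esub> i \<ominus>\<^bsub>B\<^esub> x2 \<otimes>\<^bsub>B\<^esub> j \<ominus>\<^bsub>B\<^esub> x3 \<otimes>\<^bsub>B\<^esub> (i \<otimes>\<^bsub>B\<^esub> j)))"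

definition quat_norm :: "'b set \<Rightarrow> ('b, 'm) ring_scheme \<Rightarrow> 'b \<Rightarrow> 'b" where
  "quat_norm K B x = x \<otimes>\<^bsub>B\<^esub> quat_conj K B x"

text \<open>\<open>D\<close>, together with the ring homomorphisms \<open>f : B \<rightarrow> D\<close> and \<open>g : L \<rightarrow> D\<close>, is the extension of
  scalars of the finite-dimensional \<open>K\<close>-algebra \<open>B\<close> along \<open>\<sigma> : K \<rightarrow> L\<close>, that is, the \<open>L\<close>-algebra
  given by the tensor product of \<open>B\<close> and \<open>L\<close> over \<open>K\<close>: a \<open>K\<close>-basis of \<open>B\<close> is mapped to an
  \<open>L\<close>-basis of \<open>D\<close>.\<close>

definition scalar_extension ::
    "'b set \<Rightarrow> ('b, 'm) ring_scheme \<Rightarrow> ('b \<Rightarrow> 'l) \<Rightarrow> ('l, 'n) ring_scheme \<Rightarrow>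
     ('d, 'q) ring_scheme \<Rightarrow> ('b \<Rightarrow> 'd) \<Rightarrow> ('l \<Rightarrow> 'd) \<Rightarrow> bool" where
  "scalar_extension K B \<sigma> L D f g \<longleftrightarrow>
     ring D \<and> f \<in> ring_hom B D \<and> g \<in> ring_hom L D \<and>
     (\<forall>c \<in> carrier L. \<forall>x \<in> carrier D. g c \<otimes>\<^bsub>D\<^esub> x = x \<otimes>\<^bsub>D\<^esub> g c) \<and>
     (\<forall>c \<in> K. f c = g (\<sigma> c)) \<and>
     (\<exists>Us. set Us \<subseteq> carrier B \<and>
        ring.independent B K Us \<and> ring.Span B K Us = carrier B \<and>
        ring.independent D (g ` carrier L) (map f Us) \<and>
        ring.Span D (g ` carrier L) (map f Us) = carrier D)"

text \<open>\<open>B\<close> is ramified at the real place \<open>\<sigma>\<close> if its extension of scalars along \<open>\<sigma>\<close> is a division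
  algebra. That extension has real dimension 4 and is unique up to isomorphism, so
  it may be taken with carrier in \<open>real^4\<close>.\<close>

definition ramified_at_real :: "'b set \<Rightarrow> ('b, 'm) ring_scheme \<Rightarrow> ('b \<Rightarrow> real) \<Rightarrow> bool" where
  "ramified_at_real K B \<sigma> \<longleftrightarrow>
     (\<exists>(D :: (real^4) ring) f g.
        scalar_extension K B \<sigma> (cring_class_ops :: real ring) D f g \<and>
        Units D = carrier D - {\<zero>\<^bsub>D\<^esub>})"

text \<open>An order is a subring that is a finitely generated module over the ring of integers of
  \<open>K\<close> and spans \<open>B\<close> over \<open>K\<close>. \<open>ring.Span B R Us\<close> is the set of all
  \<open>R\<close>-linear combinations of \<open>Us\<close>, also when \<open>R\<close> is not a field.\<close>

definition quaternion_order :: "'b set \<Rightarrow> ('b, 'm) ring_scheme \<Rightarrow> 'b set \<Rightarrow> bool" where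
  "quaternion_order K B Ord \<longleftrightarrow>
     subring Ord B \<and>
     (\<exists>Us. set Us \<subseteq> carrier B \<and>
        Ord = ring.Span B (ring_of_integers (B\<lparr>carrier := K\<rparr>)) Us \<and>
        ring.Span B K Us = carrier B)"

definition norm_one_elements :: "'b set \<Rightarrow> ('b, 'm) ring_scheme \<Rightarrow> 'b set \<Rightarrow> 'b set" where
  "norm_one_elements K B Ord = {x \<in> Ord. quat_norm K B x = \<one>\<^bsub>B\<^esub>}"


section \<open>PSL(2,C) and its subgroups\<close>

definition M2C :: "(complex^2^2) ring" where
  "M2C = \<lparr>carrier = UNIV, monoid.mult = (**), one = mat 1, ring.zero = 0, ring.add = (+)\<rparr>"

definition SL2C :: "(complex^2^2) monoid" where
  "SL2C = \<lparr>carrier = {A. det A = 1}, monoid.mult = (**), one = mat 1\<rparr>"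

definition PSL2C :: "(complex^2^2) set monoid" where
  "PSL2C = SL2C Mod {mat 1, - mat 1}"

definition proj_PSL2C :: "complex^2^2 \<Rightarrow> (complex^2^2) set" where
  "proj_PSL2C A = {mat 1, - mat 1} #>\<^bsub>SL2C\<^esub> A"

text \<open>The intersection has finite index in both subgroups.\<close>

definition commensurable :: "('g, 'm) monoid_scheme \<Rightarrow> 'g set \<Rightarrow> 'g set \<Rightarrow> bool" where
  "commensurable G H1 H2 \<longleftrightarrow>
     finite (rcosets\<^bsub>G\<lparr>carrier := H1\<rparr>\<^esub> (H1 \<inter> H2)) \<and>
     finite (rcosets\<^bsub>G\<lparr>carrier := H2\<rparr>\<^esub> (H1 \<inter> H2))"

definition torsion_free_subgroup :: "('g, 'm) monoid_scheme \<Rightarrow> 'g set \<Rightarrow> bool" where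
  "torsion_free_subgroup G H \<longleftrightarrow>
     (\<forall>x \<in> H. \<forall>n :: nat. n > 0 \<and> x [^]\<^bsub>G\<^esub> n = \<one>\<^bsub>G\<^esub> \<longrightarrow> x = \<one>\<^bsub>G\<^esub>)"

text \<open>\<open>\<Gamma>\<close> is a discrete torsion-free subgroup of PSL(2,C), so that the quotient of hyperbolic
  3-space by \<open>\<Gamma>\<close> is a hyperbolic 3-manifold. The elements of \<open>PSL2C\<close> are the sets \<open>{A, -A}\<close>, so
  \<open>\<Union>\<Gamma>\<close> is the preimage of \<open>\<Gamma>\<close> in SL(2,C), which is discrete if and only if \<open>\<Gamma>\<close> is.\<close>

definition hyperbolic_3_manifold_group :: "(complex^2^2) set set \<Rightarrow> bool" where
  "hyperbolic_3_manifold_group \<Gamma> \<longleftrightarrow>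
     subgroup \<Gamma> PSL2C \<and> discrete (\<Union>\<Gamma>) \<and> torsion_free_subgroup PSL2C \<Gamma>"


section \<open>Arithmetic Kleinian groups\<close>

text \<open>\<open>\<rho>\<close> is an embedding of \<open>B\<close> into \<open>M(2,C)\<close> as an algebra over \<open>K\<close>, where C is a \<open>K\<close>-algebra
  through (an embedding belonging to) the complex place of \<open>K\<close>.\<close>

definition arithmetic_data ::
    "'b set \<Rightarrow> ('b, 'm) ring_scheme \<Rightarrow> ('b \<Rightarrow> complex^2^2) \<Rightarrow> 'b set \<Rightarrow> bool" where
  "arithmetic_data K B \<rho> Ord \<longleftrightarrow>
     quaternion_algebra K B \<and>
     number_field (B\<lparr>carrier := K\<rparr>) \<and>
     card (complex_places (B\<lparr>carrier := K\<rparr>)) = 1 \<and>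
     (\<forall>\<tau> \<in> real_embeddings (B\<lparr>carrier := K\<rparr>). ramified_at_real K B \<tau>) \<and>
     \<rho> \<in> ring_hom B M2C \<and> inj_on \<rho> (carrier B) \<and>
     (\<exists>\<sigma> \<in> nonreal_embeddings (B\<lparr>carrier := K\<rparr>). \<forall>c \<in> K. \<rho> c = mat (\<sigma> c)) \<and>
     quaternion_order K B Ord"

text \<open>HOL cannot quantify over the type carrying \<open>B\<close>. The type \<open>complex^2^2\<close> is no restriction:
  \<open>\<rho>\<close> identifies any \<open>B\<close> with an isomorphic ring whose carrier consists of complex matrices, and
  \<open>arithmetic_data\<close> is invariant under isomorphism.\<close>

definition arithmetic_Kleinian_group :: "(complex^2^2) set set \<Rightarrow> bool" where
  "arithmetic_Kleinian_group \<Gamma> \<longleftrightarrow>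
     subgroup \<Gamma> PSL2C \<and>
     (\<exists>K (B :: (complex^2^2) ring) \<rho> Ord.
        arithmetic_data K B \<rho> Ord \<and>
        commensurable PSL2C \<Gamma> (proj_PSL2C ` \<rho> ` norm_one_elements K B Ord))"

end

theory Submission
  imports Defs
begin

text \<open>Write \<open>\<O>\<close> for the order and \<open>i, j\<close> for a quaternion basis of \<open>B\<close>. Since \<open>ij = -ji\<close>, the images of
  \<open>i\<close> and \<open>j\<close> in PSL(2,C) generate a Klein four-group \<open>W\<close>. Conjugation by elements of \<open>W\<close> preserves \<open>B\<close>,
  so some \<open>N > 0\<close> satisfies \<open>N t \<O> t\<^sup>-\<^sup>1 \<subseteq> \<O>\<close> for the lifts \<open>t\<close> of elements of \<open>W\<close>. If \<open>x, y \<in> \<O>\<^sup>1\<close> are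
  congruent modulo \<open>N \<O>\<close>, then \<open>x y\<^sup>-\<^sup>1 \<in> 1 + N \<O>\<close>, hence \<open>t x y\<^sup>-\<^sup>1 t\<^sup>-\<^sup>1 \<in> \<O>\<close>. As \<open>\<O> / N \<O>\<close> is finite, the
  elements of \<open>\<O>\<^sup>1\<close> all of whose \<open>W\<close>-conjugates lie in \<open>\<O>\<close> form a subgroup \<open>G\<close> of finite index,
  normalised by \<open>W\<close>, and the group \<open>W G\<close> is the required \<open>\<Gamma>\<^sub>0\<close>. That \<open>\<O>\<^sup>1\<close> is closed under inverses uses
  the integrality of the elements of \<open>\<O>\<close>.\<close>

section \<open>Commensurability\<close>

text \<open>The norms of \<open>i\<close> and \<open>j\<close> are not 1, so a lift to SL(2,C)
  divides by a complex square root of the norm, which may lie outside the field. Conjugation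
  involves only the square of that scalar, the inverse of the norm, and therefore still preserves
  \<open>B\<close>. The ring of integers enters merely as the set of integral elements of the field,
  without a basis over the integers. Finiteness of the order modulo \<open>N\<close> is instead
  drawn from the finite rational dimension of the field: every additive subgroup \<open>A\<close> of
  a finite-dimensional rational vector space has finite \<open>A / N A\<close>. Closure under
  inverses is reduced to the integrality of finitely many coefficients, those that express 1 and the
  products of \<open>x\<close> with the generators of the order. All of this takes place on the
  image of \<rho> in the 2-by-2 matrices, where quaternion conjugation becomes the adjugate and the
  norm becomes the determinant.\<close>

definition virtually_within :: "('g, 'm) monoid_scheme \<Rightarrow> 'g set \<Rightarrow> 'g set \<Rightarrow> bool" where
  "virtually_within G A B \<longleftrightarrow>
     (\<exists>S. finite S \<and> S \<subseteq> A \<and> (\<forall>x\<in>A. \<exists>s\<in>S. x \<otimes>\<^bsub>G\<^esub> inv\<^bsub>G\<^esub> s \<in> B))"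

text \<open>Pigeonhole form: a label with finitely many values, each fibre of which lies in one
  coset of \<open>B\<close>. One representative is picked from every fibre by
  \<open>inv_into\<close>.\<close>

lemma virtually_withinI:
  assumes fin: "finite (f ` A)"
    and f: "\<And>x y. x \<in> A \<Longrightarrow> y \<in> A \<Longrightarrow> f x = f y \<Longrightarrow> x \<otimes>\<^bsub>G\<^esub> inv\<^bsub>G\<^esub> y \<in> B"
  shows "virtually_within G A B"
proof -
  have "inv_into A f (f x) \<in> A" "f (inv_into A f (f x)) = f x" if "x \<in> A" for x
    using that by (simp_all add: f_inv_into_f inv_into_into)
  then have "\<exists>s\<in>inv_into A f ` f ` A. x \<otimes>\<^bsub>G\<^esub> inv\<^bsub>G\<^esub> s \<in> B" if "x \<in> A" for x
    using f[of x "inv_into A f (f x)"] that by auto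
  moreover have "inv_into A f ` f ` A \<subseteq> A"
    by (auto simp: inv_into_into)
  ultimately show ?thesis
    unfolding virtually_within_def using fin by (intro exI[of _ "inv_into A f ` f ` A"]) auto
qed

context group
begin

text \<open>Label \<open>x\<close> by the pair of representatives met on the way from
  \<open>A\<close> through \<open>B\<close> to \<open>C\<close>. If \<open>x\<close> and
  \<open>y\<close> share the label, both become elements of \<open>C\<close> after right
  multiplication by the same \<open>z\<close>, and \<open>z\<close> cancels in the quotient.\<close>

lemma virtually_within_trans:
  assumes AB: "virtually_within G A B" and BC: "virtually_within G B C"
    and A: "A \<subseteq> carrier G" and B: "B \<subseteq> carrier G" and C: "subgroup C G"
  shows "virtually_within G A C"
proof -
  obtain S where S: "finite S" "S \<subseteq> A" "\<forall>x\<in>A. \<exists>s\<in>S. x \<otimes> inv s \<in> B"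
    using AB unfolding virtually_within_def by blast
  obtain T where T: "finite T" "T \<subseteq> B" "\<forall>x\<in>B. \<exists>s\<in>T. x \<otimes> inv s \<in> C"
    using BC unfolding virtually_within_def by blast
  have "\<exists>s t. s \<in> S \<and> t \<in> T \<and> x \<otimes> inv s \<otimes> inv t \<in> C" if "x \<in> A" for x
    using S(3) T(3) that by blast
  then obtain s t where st: "\<And>x. x \<in> A \<Longrightarrow> s x \<in> S \<and> t x \<in> T \<and> x \<otimes> inv s x \<otimes> inv t x \<in> C"
    by metis
  show ?thesis
  proof (rule virtually_withinI)
    show "finite ((\<lambda>x. (s x, t x)) ` A)"
      by (rule finite_subset[of _ "S \<times> T"]) (use st S(1) T(1) in auto)
    fix x y assume xy: "x \<in> A" "y \<in> A" "(s x, t x) = (s y, t y)"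
    have car: "x \<in> carrier G" "y \<in> carrier G" "s y \<in> carrier G" "t y \<in> carrier G"
      using xy A B S(2) T(2) st by blast+
    have "x \<otimes> inv s y \<otimes> inv t y \<in> C" "y \<otimes> inv s y \<otimes> inv t y \<in> C"
      using st[of x] st[of y] xy by auto
    then have "(x \<otimes> inv s y \<otimes> inv t y) \<otimes> inv (y \<otimes> inv s y \<otimes> inv t y) \<in> C"
      by (meson C subgroup.m_closed subgroup.m_inv_closed)
    moreover have "(x \<otimes> inv s y \<otimes> inv t y) \<otimes> inv (y \<otimes> inv s y \<otimes> inv t y) = x \<otimes> inv y"
    proof -
      define z where "z = inv s y \<otimes> inv t y"
      have z: "z \<in> carrier G" using car by (simp add: z_def)
      have "(x \<otimes> z) \<otimes> inv (y \<otimes> z) = x \<otimes> (z \<otimes> inv z) \<otimes> inv y"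
        using car z by (simp only: inv_mult_group m_assoc m_closed inv_closed)
      then show ?thesis using car z
        by (metis z_def inv_closed m_assoc r_inv r_one)
    qed
    ultimately show "x \<otimes> inv y \<in> C" by simp
  qed
qed

text \<open>For \<open>x\<close> and \<open>y\<close> in \<open>A\<close> the quotient is in
  \<open>A\<close> anyway, so lying in the same coset of the intersection only tests membership in
  \<open>B\<close>. This links the representative form of finite index to the coset form in
  \<open>commensurable\<close>.\<close>

lemma finite_rcosets_iff_virtually_within:
  assumes A: "subgroup A G" and B: "subgroup B G"
  shows "finite (rcosets\<^bsub>G\<lparr>carrier := A\<rparr>\<^esub> (A \<inter> B)) \<longleftrightarrow> virtually_within G A B"
proof -
  have AB: "subgroup (A \<inter> B) G"
    using A B by (rule subgroups_Inter_pair)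
  have rc: "rcosets\<^bsub>G\<lparr>carrier := A\<rparr>\<^esub> (A \<inter> B) = (\<lambda>x. (A \<inter> B) #> x) ` A"
    by (auto simp: RCOSETS_def r_coset_def)
  have Asub: "A \<subseteq> carrier G" using A by (rule subgroup.subset)
  have eq: "(A \<inter> B) #> x = (A \<inter> B) #> y \<longleftrightarrow> x \<otimes> inv y \<in> B" if xy: "x \<in> A" "y \<in> A" for x y
  proof
    assume "(A \<inter> B) #> x = (A \<inter> B) #> y"
    then have "x \<in> (A \<inter> B) #> y"
      using AB xy Asub rcos_self by blast
    then show "x \<otimes> inv y \<in> B"
      using subgroup.rcos_module_imp[OF AB is_group] xy Asub by blast
  next
    assume "x \<otimes> inv y \<in> B"
    then have "x \<otimes> inv y \<in> A \<inter> B"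
      using A xy by (simp add: subgroup.m_closed subgroup.m_inv_closed)
    then have "x \<in> (A \<inter> B) #> y"
      using subgroup.rcos_module_rev[OF AB is_group] xy Asub by blast
    then show "(A \<inter> B) #> x = (A \<inter> B) #> y"
      using repr_independence[OF _ _ AB] xy Asub by blast
  qed
  show ?thesis
  proof
    assume "finite (rcosets\<^bsub>G\<lparr>carrier := A\<rparr>\<^esub> (A \<inter> B))"
    then show "virtually_within G A B"
      unfolding rc using eq by (intro virtually_withinI[where f = "\<lambda>x. (A \<inter> B) #> x"]) auto
  next
    assume "virtually_within G A B"
    then obtain S where S: "finite S" "S \<subseteq> A" "\<forall>x\<in>A. \<exists>s\<in>S. x \<otimes> inv s \<in> B"
      unfolding virtually_within_def by blast
    have "(\<lambda>x. (A \<inter> B) #> x) ` A \<subseteq> (\<lambda>x. (A \<inter> B) #> x) ` S"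
    proof (rule image_subsetI)
      fix x assume x: "x \<in> A"
      then obtain s where s: "s \<in> S" "x \<otimes> inv s \<in> B" using S(3) by blast
      then have "(A \<inter> B) #> x = (A \<inter> B) #> s" using eq x S(2) by blast
      then show "(A \<inter> B) #> x \<in> (\<lambda>x. (A \<inter> B) #> x) ` S" using s(1) by blast
    qed
    then show "finite (rcosets\<^bsub>G\<lparr>carrier := A\<rparr>\<^esub> (A \<inter> B))"
      unfolding rc using S(1) finite_subset by blast
  qed
qed

lemma commensurable_iff_virtually_within:
  assumes "subgroup A G" "subgroup B G"
  shows "commensurable G A B \<longleftrightarrow> virtually_within G A B \<and> virtually_within G B A"
  using finite_rcosets_iff_virtually_within[OF assms] finite_rcosets_iff_virtually_within[OF assms(2,1)]
  by (simp add: commensurable_def Int_commute)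

lemma commensurable_trans:
  assumes "subgroup A G" "subgroup B G" "subgroup C G"
    and "commensurable G A B" "commensurable G B C"
  shows "commensurable G A C"
  using assms(4,5) virtually_within_trans[OF _ _ assms(1,2)[THEN subgroup.subset] assms(3)]
    virtually_within_trans[OF _ _ assms(3,2)[THEN subgroup.subset] assms(1)]
  by (simp add: commensurable_iff_virtually_within assms(1-3))

lemma commensurable_sym: "commensurable G A B \<longleftrightarrow> commensurable G B A"
  by (auto simp: commensurable_def Int_commute)

lemma klein_four_subgroup:
  assumes a: "a \<in> carrier G" "a \<otimes> a = \<one>" "a \<noteq> \<one>"
    and b: "b \<in> carrier G" "b \<otimes> b = \<one>" "b \<noteq> \<one>"
    and ab: "a \<otimes> b = b \<otimes> a" "a \<noteq> b"
  shows "subgroup {\<one>, a, b, a \<otimes> b} G"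
    and "G\<lparr>carrier := {\<one>, a, b, a \<otimes> b}\<rparr> \<cong> integer_mod_group 2 \<times>\<times> integer_mod_group 2"
proof -
  let ?V = "{\<one>, a, b, a \<otimes> b}"
  have aab: "a \<otimes> (a \<otimes> b) = b" 
    using a b by (simp flip: m_assoc)
  have bab: "b \<otimes> (a \<otimes> b) = a"
    using a b ab by (metis m_assoc r_one)
  have aba: "a \<otimes> b \<otimes> a = b" using a b ab by (metis aab m_assoc)
  have abb: "a \<otimes> b \<otimes> b = a" using a b by (simp add: m_assoc)
  have abab: "a \<otimes> b \<otimes> (a \<otimes> b) = \<one>" using a b by (simp add: m_assoc bab)
  \<comment> \<open>A trivial product would make \<open>b\<close> the inverse of the involution
    \<open>a\<close>, that is, \<open>a\<close> itself.\<close>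
  have ab1: "a \<otimes> b \<noteq> \<one>"
    using a b ab(2) by (metis inv_equality inv_char)
  have aba': "a \<otimes> b \<noteq> a" "a \<otimes> b \<noteq> b"
    using a b by (metis r_cancel_one' r_cancel_one l_cancel_one' l_cancel_one)+
  have invs: "inv a = a" "inv b = b" "inv (a \<otimes> b) = a \<otimes> b"
    using a b abab by (auto intro!: inv_equality)
  show sub: "subgroup ?V G"
    by (rule subgroupI) (use a b invs aab bab aba abb abab ab(1)[symmetric] in auto)
  define h where "h = (\<lambda>(m::int, n::int). if m = 0 then (if n = 0 then \<one> else b) else (if n = 0 then a else a \<otimes> b))"
  have car: "carrier (integer_mod_group 2 \<times>\<times> integer_mod_group 2) = {(0,0),(0,1),(1,0),(1,1)}"
    by (auto simp: carrier_integer_mod_group)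
  have h: "h (0,0) = \<one>" "h (0,1) = b" "h (1,0) = a" "h (1,1) = a \<otimes> b"
    by (simp_all add: h_def)
  have "h \<in> hom (integer_mod_group 2 \<times>\<times> integer_mod_group 2) (G\<lparr>carrier := ?V\<rparr>)"
  proof (rule homI)
    fix x assume "x \<in> carrier (integer_mod_group 2 \<times>\<times> integer_mod_group 2)"
    then show "h x \<in> carrier (G\<lparr>carrier := ?V\<rparr>)" unfolding car using h by auto
  next
    fix x y assume "x \<in> carrier (integer_mod_group 2 \<times>\<times> integer_mod_group 2)"
      "y \<in> carrier (integer_mod_group 2 \<times>\<times> integer_mod_group 2)"
    then show "h (x \<otimes>\<^bsub>integer_mod_group 2 \<times>\<times> integer_mod_group 2\<^esub> y) = h x \<otimes>\<^bsub>G\<lparr>carrier := ?V\<rparr>\<^esub> h y"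
      unfolding car by (elim insertE emptyE) (simp_all add: h a b aab bab aba abb abab ab(1)[symmetric])
  qed
  moreover have "bij_betw h {(0,0),(0,1),(1,0),(1,1)} ?V"
    unfolding bij_betw_def inj_on_def
    using h a(3) b(3) ab(2) ab1 aba' a(3)[symmetric] b(3)[symmetric] ab(2)[symmetric] ab1[symmetric] aba'[symmetric]
    by (auto simp del: r_cancel_one r_cancel_one' l_cancel_one l_cancel_one')
  ultimately have "h \<in> iso (integer_mod_group 2 \<times>\<times> integer_mod_group 2) (G\<lparr>carrier := ?V\<rparr>)"
    unfolding iso_def car by simp
  then show "G\<lparr>carrier := ?V\<rparr> \<cong> integer_mod_group 2 \<times>\<times> integer_mod_group 2"
    using group.iso_sym[OF DirProd_group] group_integer_mod_group is_isoI by blast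
qed

end

text \<open>Carries the finite-index estimates, which are made with matrices in SL(2,C), over to
  PSL(2,C).\<close>

lemma virtually_within_hom_image:
  assumes "group_hom G H h" and A: "A \<subseteq> carrier G" and AB: "virtually_within G A B"
  shows "virtually_within H (h ` A) (h ` B)"
proof -
  obtain S where S: "finite S" "S \<subseteq> A"
    and SB: "\<And>x. x \<in> A \<Longrightarrow> \<exists>s\<in>S. x \<otimes>\<^bsub>G\<^esub> inv\<^bsub>G\<^esub> s \<in> B"
    using AB unfolding virtually_within_def by auto
  interpret gh: group_hom G H h by fact
  have "\<exists>s\<in>h ` S. h x \<otimes>\<^bsub>H\<^esub> inv\<^bsub>H\<^esub> s \<in> h ` B" if "x \<in> A" for x
  proof -
    obtain s where s: "s \<in> S" "x \<otimes>\<^bsub>G\<^esub> inv\<^bsub>G\<^esub> s \<in> B" using SB[OF \<open>x \<in> A\<close>] by auto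
    have "h (x \<otimes>\<^bsub>G\<^esub> inv\<^bsub>G\<^esub> s) = h x \<otimes>\<^bsub>H\<^esub> inv\<^bsub>H\<^esub> h s"
      using s(1) S(2) A that by (metis gh.G.inv_closed gh.hom_inv gh.hom_mult subsetD)
    then show ?thesis using s by (metis image_eqI)
  qed
  then show ?thesis
    unfolding virtually_within_def by (intro exI[of _ "h ` S"]) (use S in auto)
qed

section \<open>Finitely generated abelian groups\<close>

text \<open>Restriction of scalars to the rationals, which makes span, independence and dimension
  bounds over the rationals available for complex numbers and for complex matrices alike.\<close>

definition rat_scale :: "rat \<Rightarrow> 'a::real_vector \<Rightarrow> 'a" where
  "rat_scale q x = real_of_rat q *\<^sub>R x"

interpretation rat_vs: vector_space "rat_scale :: rat \<Rightarrow> 'a::real_vector \<Rightarrow> 'a"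
  by unfold_locales (auto simp: rat_scale_def algebra_simps of_rat_add of_rat_mult)

definition add_closed :: "'a::ab_group_add set \<Rightarrow> bool" where
  "add_closed A \<longleftrightarrow> 0 \<in> A \<and> (\<forall>x\<in>A. \<forall>y\<in>A. x - y \<in> A)"

lemma add_closed_zero: "add_closed A \<Longrightarrow> 0 \<in> A"
  by (simp add: add_closed_def)

lemma add_closed_minus: "add_closed A \<Longrightarrow> x \<in> A \<Longrightarrow> - x \<in> A"
  unfolding add_closed_def by (metis diff_0)

lemma add_closed_add: "add_closed A \<Longrightarrow> x \<in> A \<Longrightarrow> y \<in> A \<Longrightarrow> x + y \<in> A"
  by (metis add_closed_def add_closed_minus diff_minus_eq_add)

lemma add_closed_of_nat:
  "add_closed A \<Longrightarrow> x \<in> A \<Longrightarrow> of_nat n *\<^sub>R (x::'a::real_vector) \<in> A"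
  by (induction n) (auto simp: algebra_simps add_closed_add, simp add: add_closed_def)

section \<open>Finiteness of A / N A for additive subgroups of finite-dimensional rational
  spaces\<close>

definition finite_mod :: "nat \<Rightarrow> 'a::real_vector set \<Rightarrow> bool" where
  "finite_mod N A \<longleftrightarrow> (\<exists>S. finite S \<and> S \<subseteq> A \<and> (\<forall>x\<in>A. \<exists>s\<in>S. \<exists>y\<in>A. x = s + of_nat N *\<^sub>R y))"

lemma finite_rat_common_denominator:
  assumes "finite (Q :: rat set)"
  shows "\<exists>d::nat. d > 0 \<and> (\<forall>x\<in>Q. of_nat d * x \<in> \<int>)"
  using assms
proof (induction Q)
  case empty then show ?case by (auto intro: exI[of _ 1])
next
  case (insert x Q)
  then obtain d :: nat where d: "d > 0" "\<forall>x\<in>Q. of_nat d * x \<in> \<int>" by blast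
  obtain a b where ab: "x = of_int a / of_int b" "b > 0"
    by (metis quotient_of_denom_pos quotient_of_div surj_pair)
  have "of_nat (d * nat b) * y \<in> \<int>" if "y \<in> insert x Q" for y
  proof (cases "y = x")
    case True
    have "rat_of_nat (d * nat b) * x = of_int (int d * a)"
      using ab by simp
    then show ?thesis using True by (metis Ints_of_int)
  next
    case False
    then have "of_nat d * y \<in> \<int>" using that d by blast
    then have "rat_of_nat (nat b) * (of_nat d * y) \<in> \<int>" by (rule Ints_mult[OF Ints_of_nat])
    moreover have "of_nat (nat b) * (of_nat d * y) = of_nat (d * nat b) * y" by (simp only: of_nat_mult mult_ac)
    ultimately show ?thesis by (simp only:)
  qed
  then show ?case using d ab by (intro exI[of _ "d * nat b"]) auto
qed

lemma add_closed_of_int_mult: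
  fixes x :: "'a::ring_1"
  assumes A: "add_closed A" and x: "x \<in> A"
  shows "of_int k * x \<in> A"
proof -
  have nat: "of_nat n * x \<in> A" for n
    by (induction n) (use x A in \<open>auto simp: algebra_simps add_closed_add add_closed_zero\<close>)
  show ?thesis
  proof (cases k rule: int_cases)
    case (neg n)
    then show ?thesis
      using add_closed_minus[OF A nat[of "Suc n"]] unfolding neg by (metis mult_minus_left of_int_minus of_int_of_nat_eq)
  qed (use nat in auto)
qed

text \<open>Division with remainder by the least positive element; the trivial group has generator
  0.\<close>

lemma add_closed_int_principal:
  assumes Y: "add_closed (Y :: int set)"
  shows "\<exists>g\<in>Y. \<forall>y\<in>Y. g dvd y"
proof (cases "Y \<subseteq> {0}")
  case True
  then show ?thesis using add_closed_zero[OF Y] by auto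
next
  case False
  then obtain y where y: "y \<in> Y" "y \<noteq> 0" by blast
  then have "nat \<bar>y\<bar> > 0 \<and> int (nat \<bar>y\<bar>) \<in> Y"
    using add_closed_minus[OF Y y(1)] by (cases "y > 0") auto
  then obtain n :: nat where n: "n > 0" "int n \<in> Y" "\<And>m. m > 0 \<Longrightarrow> int m \<in> Y \<Longrightarrow> n \<le> m"
    using exists_least_iff[of "\<lambda>n. n > 0 \<and> int n \<in> Y"] by (metis linorder_not_less)
  have "int n dvd z" if z: "z \<in> Y" for z
  proof -
    have "z - of_int (z div int n) * int n \<in> Y"
      using Y z add_closed_of_int_mult[OF Y n(2)] by (meson add_closed_def)
    then have mem: "z mod int n \<in> Y" by (simp add: minus_div_mult_eq_mod)
    have "\<not> nat (z mod int n) > 0"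
    proof
      assume "nat (z mod int n) > 0"
      then have "n \<le> nat (z mod int n)" using n(3) mem by simp
      moreover have "z mod int n < int n" using n(1) by simp
      ultimately show False using n(1) by (simp add: le_nat_iff)
    qed
    moreover have "0 \<le> z mod int n" using n(1) by simp
    ultimately have "z mod int n = 0" by linarith
    then show ?thesis by (rule mod_0_imp_dvd)
  qed
  then show ?thesis using n(2) by blast
qed

text \<open>Finitely many rationals generate a cyclic group, so \<open>H / N H\<close> has at most \<open>N\<close> elements.\<close>

lemma finite_mod_rat:
  fixes H :: "rat set"
  assumes H: "add_closed H" and N: "N > 0"
  shows "\<exists>S. finite S \<and> S \<subseteq> H \<and> (\<forall>x\<in>H. \<exists>s\<in>S. \<exists>y\<in>H. x = s + of_nat N * y)"
proof (rule ccontr)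
  assume neg: "\<not> ?thesis"
  have step: "\<exists>x\<in>H. \<forall>s\<in>S. \<forall>y\<in>H. x \<noteq> s + of_nat N * y" if "finite S" "S \<subseteq> H" for S
  proof -
    have "\<not> (finite S \<and> S \<subseteq> H \<and> (\<forall>x\<in>H. \<exists>s\<in>S. \<exists>y\<in>H. x = s + of_nat N * y))"
      using neg by (rule contrapos_nn) (rule exI[of _ S])
    then show ?thesis using that by simp
  qed
  \<comment> \<open>If no finite set represents all classes, pairwise incongruent elements can be
    added one at a time; \<open>Suc N\<close> of them will be too many.\<close>
  have "\<exists>S. finite S \<and> card S = n \<and> S \<subseteq> H \<and> (\<forall>s\<in>S. \<forall>t\<in>S. s \<noteq> t \<longrightarrow> (\<forall>y\<in>H. s \<noteq> t + of_nat N * y))" for n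
  proof (induction n)
    case 0 then show ?case by (intro exI[of _ "{}"]) auto
  next
    case (Suc n)
    then obtain S where S: "finite S" "card S = n" "S \<subseteq> H"
      and SN: "\<And>s t y. s \<in> S \<Longrightarrow> t \<in> S \<Longrightarrow> s \<noteq> t \<Longrightarrow> y \<in> H \<Longrightarrow> s \<noteq> t + of_nat N * y" by auto
    obtain x where x: "x \<in> H" "\<And>s y. s \<in> S \<Longrightarrow> y \<in> H \<Longrightarrow> x \<noteq> s + of_nat N * y"
      using step[OF S(1,3)] by blast
    have "x \<notin> S" using x(2)[of x 0] add_closed_zero[OF H] by auto
    moreover have "s \<noteq> x + of_nat N * y" if "s \<in> S" "y \<in> H" for s y
      using x(2)[OF that(1) add_closed_minus[OF H that(2)]] by auto
    ultimately show ?case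
      using S x SN by (intro exI[of _ "insert x S"]) auto
  qed
  from this[of "Suc N"] obtain S where S: "finite S" "card S = Suc N" "S \<subseteq> H"
    and SN: "\<And>s t y. s \<in> S \<Longrightarrow> t \<in> S \<Longrightarrow> s \<noteq> t \<Longrightarrow> y \<in> H \<Longrightarrow> s \<noteq> t + of_nat N * y" by auto
  obtain d :: nat where d: "d > 0" "\<forall>x\<in>S. of_nat d * x \<in> \<int>"
    using finite_rat_common_denominator[OF S(1)] by blast
  \<comment> \<open>\<open>Y\<close> consists of the numerators, over the common denominator
    \<open>d\<close>, of elements of \<open>H\<close>. With \<open>g\<close> a generator of
    \<open>Y\<close>, every member of \<open>S\<close> is an integer multiple of
    \<open>g / d\<close>, which itself lies in \<open>H\<close>.\<close>
  define Y where "Y = {z :: int. of_int z / of_nat d \<in> H}"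
  have Y: "add_closed Y"
    using H by (auto simp: add_closed_def Y_def diff_divide_distrib)
  have fl: "of_int \<lfloor>of_nat d * x\<rfloor> = of_nat d * x" if "x \<in> S" for x
    using d that by (metis floor_of_int Ints_cases)
  obtain g where g: "g \<in> Y" "\<forall>y\<in>Y. g dvd y"
    using add_closed_int_principal[OF Y] by blast
  have "\<lfloor>of_nat d * x\<rfloor> \<in> Y" if "x \<in> S" for x
  proof -
    have "of_int \<lfloor>of_nat d * x\<rfloor> / of_nat d = x" unfolding fl[OF that] using d(1) by simp
    then show ?thesis using S(3) that by (simp add: Y_def subset_eq)
  qed
  then have "\<exists>c. \<lfloor>of_nat d * x\<rfloor> = c * g" if "x \<in> S" for x
    using g(2) that by (metis dvd_def mult.commute)
  then obtain c where c: "\<And>x. x \<in> S \<Longrightarrow> \<lfloor>of_nat d * x\<rfloor> = c x * g" by metis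
  have cx: "x = of_int (c x) * (of_int g / of_nat d)" if "x \<in> S" for x
  proof -
    have "of_nat d * x = of_int (c x * g)" using fl[OF that] unfolding c[OF that] by (rule sym)
    then show ?thesis using d(1) by (simp add: field_simps)
  qed
  \<comment> \<open>\<open>N + 1\<close> multipliers have only \<open>N\<close> residues. Two that
    agree differ by \<open>N k\<close>, so their elements differ by \<open>N\<close> times a member
    of \<open>H\<close>.\<close>
  have "card ((\<lambda>x. c x mod int N) ` S) \<le> card {0..<int N}"
    by (rule card_mono) (use N in auto)
  then have "\<not> inj_on (\<lambda>x. c x mod int N) S"
    using S(2) card_image by fastforce
  then obtain s t where st: "s \<in> S" "t \<in> S" "s \<noteq> t" "c s mod int N = c t mod int N"
    unfolding inj_on_def by blast
  then have "int N dvd c s - c t" by (simp add: mod_eq_dvd_iff)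
  then obtain k where k: "c s - c t = int N * k" by (rule dvdE)
  have "s - t = of_int (c s - c t) * (of_int g / of_nat d)"
    using cx[OF st(1)] cx[OF st(2)] by (simp add: algebra_simps)
  also have "\<dots> = of_nat N * (of_int k * (of_int g / of_nat d))"
    unfolding k by simp
  finally have eq: "s = t + of_nat N * (of_int k * (of_int g / of_nat d))" by simp
  have "of_int k * (of_int g / of_nat d) \<in> H"
    using g(1) by (intro add_closed_of_int_mult[OF H]) (simp add: Y_def)
  then show False using SN[OF st(1-3)] eq by blast
qed

text \<open>Induction on the generators: \<open>A\<close> is an extension of a group
  \<open>H\<close> of rationals by its intersection with the smaller span, and representatives for
  both ends combine. As \<open>b\<close> may depend on \<open>B\<close>, \<open>H\<close> collects
  all possible coefficients of \<open>b\<close>.\<close>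

lemma finite_mod_span:
  fixes A :: "'a::real_vector set"
  assumes "finite B" "A \<subseteq> rat_vs.span B" "add_closed A" and N: "N > 0"
  shows "finite_mod N A"
  using assms(1-3)
proof (induction B arbitrary: A)
  case empty
  then have "A = {0}" by (auto simp: add_closed_def)
  then show ?case by (auto simp: finite_mod_def)
next
  case (insert b B)
  define H where "H = {k. \<exists>s\<in>rat_vs.span B. rat_scale k b + s \<in> A}"
  define A' where "A' = A \<inter> rat_vs.span B"
  have "add_closed A'"
    using insert.prems(2) by (auto simp: add_closed_def A'_def rat_vs.span_zero rat_vs.span_diff)
  then obtain S' where S': "finite S'" "S' \<subseteq> A'" "\<forall>x\<in>A'. \<exists>s\<in>S'. \<exists>y\<in>A'. x = s + of_nat N *\<^sub>R y"
    using insert.IH[of A'] unfolding A'_def finite_mod_def by blast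
  have "add_closed H"
    unfolding add_closed_def
  proof (intro conjI ballI)
    show "0 \<in> H" using insert.prems(2) rat_vs.span_zero by (force simp: H_def add_closed_def)
    fix k l assume "k \<in> H" "l \<in> H"
    then obtain s t where st: "s \<in> rat_vs.span B" "t \<in> rat_vs.span B" "rat_scale k b + s \<in> A" "rat_scale l b + t \<in> A"
      by (auto simp: H_def)
    then have "(rat_scale k b + s) - (rat_scale l b + t) \<in> A"
      using insert.prems(2) by (simp add: add_closed_def)
    moreover have "(rat_scale k b + s) - (rat_scale l b + t) = rat_scale (k - l) b + (s - t)"
      by (simp add: rat_vs.scale_left_diff_distrib)
    ultimately show "k - l \<in> H" using st rat_vs.span_diff by (auto simp: H_def)
  qed
  from finite_mod_rat[OF this N] obtain T
    where T: "finite T" "T \<subseteq> H" "\<forall>x\<in>H. \<exists>s\<in>T. \<exists>y\<in>H. x = s + of_nat N * y"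
    by auto
  have "\<exists>a. a \<in> A \<and> a - rat_scale k b \<in> rat_vs.span B" if k: "k \<in> H" for k
  proof -
    obtain s where "s \<in> rat_vs.span B" "rat_scale k b + s \<in> A" using k by (auto simp: H_def)
    then show ?thesis by (intro exI[of _ "rat_scale k b + s"]) simp
  qed
  \<comment> \<open>\<open>w k\<close> lifts the coefficient \<open>k\<close> to an element of
    \<open>A\<close>; no additivity of the lift is claimed.\<close>
  then obtain w where w: "\<And>k. k \<in> H \<Longrightarrow> w k \<in> A \<and> w k - rat_scale k b \<in> rat_vs.span B" by metis
  have "\<exists>s\<in>(\<lambda>(t, s). w t + s) ` (T \<times> S'). \<exists>y\<in>A. x = s + of_nat N *\<^sub>R y" if x: "x \<in> A" for x
  proof -
    obtain k where k: "x - rat_scale k b \<in> rat_vs.span B"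
      using x insert.prems(1) rat_vs.span_breakdown_eq by blast
    then have "k \<in> H" using x by (auto simp: H_def intro!: bexI[of _ "x - rat_scale k b"])
    then obtain t l where tl: "t \<in> T" "l \<in> H" "k = t + of_nat N * l" using T by blast
    \<comment> \<open>Since \<open>k = t + N l\<close>, subtracting the lift of \<open>t\<close> and
      \<open>N\<close> times the lift of \<open>l\<close> cancels the multiple of \<open>b\<close>,
      which leaves an element of \<open>A'\<close>.\<close>
    have eq: "x - w t - of_nat N *\<^sub>R w l = (x - rat_scale k b) - (w t - rat_scale t b) - rat_scale (of_nat N) (w l - rat_scale l b)"
      unfolding tl(3) by (simp add: rat_scale_def algebra_simps of_rat_add of_rat_mult)
    have "x - w t - of_nat N *\<^sub>R w l \<in> rat_vs.span B"
      unfolding eq using w[OF tl(2)] w[of t] tl(1) T(2)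
      by (intro rat_vs.span_diff[OF rat_vs.span_diff[OF k] rat_vs.span_scale]) auto
    moreover have "x - w t - of_nat N *\<^sub>R w l \<in> A"
      using insert.prems(2) x w tl T(2) add_closed_of_nat[OF insert.prems(2)]
      by (meson add_closed_def subset_eq)
    ultimately have "x - w t - of_nat N *\<^sub>R w l \<in> A'" by (simp add: A'_def)
    then obtain s y where sy: "s \<in> S'" "y \<in> A'" "x - w t - of_nat N *\<^sub>R w l = s + of_nat N *\<^sub>R y"
      using S' by blast
    have "x = (w t + s) + of_nat N *\<^sub>R (y + w l)"
      using sy(3) by (simp add: algebra_simps)
    moreover have "y + w l \<in> A"
      using sy(2) w[OF tl(2)] add_closed_add[OF insert.prems(2)] by (simp add: A'_def)
    ultimately show ?thesis using tl(1) sy(1) by force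
  qed
  moreover have "(\<lambda>(t, s). w t + s) ` (T \<times> S') \<subseteq> A"
    using T(2) S'(2) w by (auto simp: A'_def intro!: add_closed_add[OF insert.prems(2)])
  ultimately show ?case
    unfolding finite_mod_def using T(1) S'(1) by (intro exI[of _ "(\<lambda>(t, s). w t + s) ` (T \<times> S')"]) auto
qed

section \<open>Integer spans and the Noetherian property of the integers\<close>

lemma (in Modules.module) span_image_lessThan:
  "x \<in> span (f ` {..<n}) \<Longrightarrow> \<exists>q. x = (\<Sum>m<n. scale (q m) (f m))" for n :: nat
proof (induction n arbitrary: x)
  case 0 then show ?case by simp
next
  case (Suc n)
  then obtain k where k: "x - scale k (f n) \<in> span (f ` {..<n})"
    by (auto simp: lessThan_Suc span_breakdown_eq)
  then obtain q where q: "x - scale k (f n) = (\<Sum>m<n. scale (q m) (f m))" using Suc.IH by blast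
  \<comment> \<open>The family \<open>f\<close> may repeat values, so the new coefficient belongs to
    the index \<open>n\<close> and not to the vector \<open>f n\<close>.\<close>
  have "x = (\<Sum>m<Suc n. scale ((q(n := k)) m) (f m))"
    using q by (simp add: algebra_simps)
  then show ?case by blast
qed

definition int_scale :: "int \<Rightarrow> 'a::real_vector \<Rightarrow> 'a" where
  "int_scale n x = of_int n *\<^sub>R x"

interpretation int_mod: Modules.module "int_scale :: int \<Rightarrow> 'a::real_vector \<Rightarrow> 'a"
  by unfold_locales (auto simp: int_scale_def algebra_simps)

lemma add_closed_int_span: "add_closed (int_mod.span S)"
  by (simp add: add_closed_def int_mod.span_zero int_mod.span_diff)

lemma int_scale_in_add_closed:
  assumes "add_closed A" "x \<in> A" shows "int_scale k x \<in> A"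
proof (cases k rule: int_cases)
  case (nonneg m) then show ?thesis using add_closed_of_nat[OF assms, of m] by (simp add: int_scale_def)
next
  case (neg m)
  have "int_scale k x = - (of_nat (Suc m) *\<^sub>R x)"
    unfolding neg int_scale_def by (metis of_int_minus of_int_of_nat_eq scaleR_minus_left)
  then show ?thesis
    using add_closed_minus[OF assms(1) add_closed_of_nat[OF assms, of "Suc m"]] by simp
qed

lemma int_span_subset_add_closed:
  assumes "add_closed A" "S \<subseteq> A" shows "int_mod.span S \<subseteq> A"
  using assms int_scale_in_add_closed[OF assms(1)] add_closed_add[OF assms(1)]
  by (intro int_mod.span_minimal) (auto simp: int_mod.subspace_def add_closed_zero)

lemma int_span_linear_image:
  assumes f: "linear f" and S: "f ` S \<subseteq> int_mod.span S'" and x: "x \<in> int_mod.span S"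
  shows "f x \<in> int_mod.span S'"
proof -
  have "add_closed {x. f x \<in> int_mod.span S'}"
    using add_closed_int_span[of S'] by (auto simp: add_closed_def linear_0[OF f] linear_diff[OF f])
  from int_span_subset_add_closed[OF this] show ?thesis using S x by blast
qed

lemma rat_span_linear_image:
  assumes f: "linear f" and S: "f ` S \<subseteq> rat_vs.span S'" and x: "x \<in> rat_vs.span S"
  shows "f x \<in> rat_vs.span S'"
proof -
  have "f (rat_scale c x) = rat_scale c (f x)" for c x
    by (simp add: rat_scale_def linear_scale[OF f])
  then have "rat_vs.subspace {x. f x \<in> rat_vs.span S'}"
    by (auto simp: rat_vs.subspace_def linear_0[OF f] linear_add[OF f]
        intro: rat_vs.span_zero rat_vs.span_add rat_vs.span_scale)
  from rat_vs.span_minimal[OF _ this] show ?thesis using S x by blast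
qed

text \<open>The coefficients of \<open>b\<close> that occur in \<open>A\<close> form a cyclic group.
  One element of \<open>A\<close> whose coefficient is its generator \<open>g\<close>, added to
  generators of the part of \<open>A\<close> in the smaller span, generates
  \<open>A\<close>.\<close>

lemma add_closed_finitely_generated:
  fixes A :: "'a::real_vector set"
  assumes "finite B" "A \<subseteq> int_mod.span B" "add_closed A"
  shows "\<exists>T. finite T \<and> T \<subseteq> A \<and> A \<subseteq> int_mod.span T"
  using assms
proof (induction B arbitrary: A)
  case empty
  then show ?case by (intro exI[of _ "{}"]) auto
next
  case (insert b B)
  define Y where "Y = {k. \<exists>s\<in>int_mod.span B. int_scale k b + s \<in> A}"
  have "add_closed (A \<inter> int_mod.span B)"
    using insert.prems(2) add_closed_int_span[of B] by (auto simp: add_closed_def)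
  then obtain T where T: "finite T" "T \<subseteq> A \<inter> int_mod.span B" "A \<inter> int_mod.span B \<subseteq> int_mod.span T"
    using insert.IH[of "A \<inter> int_mod.span B"] by blast
  have "add_closed Y"
    unfolding add_closed_def
  proof (intro conjI ballI)
    show "0 \<in> Y" using add_closed_zero[OF insert.prems(2)] int_mod.span_zero by (force simp: Y_def)
    fix k l assume "k \<in> Y" "l \<in> Y"
    then obtain s t where st: "s \<in> int_mod.span B" "t \<in> int_mod.span B"
      "int_scale k b + s \<in> A" "int_scale l b + t \<in> A"
      by (auto simp: Y_def)
    then have "(int_scale k b + s) - (int_scale l b + t) \<in> A"
      using insert.prems(2) by (simp add: add_closed_def)
    moreover have "(int_scale k b + s) - (int_scale l b + t) = int_scale (k - l) b + (s - t)"
      by (simp add: int_mod.scale_left_diff_distrib)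
    ultimately show "k - l \<in> Y" using st int_mod.span_diff by (auto simp: Y_def)
  qed
  then obtain g where g: "g \<in> Y" "\<forall>y\<in>Y. g dvd y" using add_closed_int_principal by blast
  obtain s where s: "s \<in> int_mod.span B" "int_scale g b + s \<in> A" using g(1) by (auto simp: Y_def)
  let ?w = "int_scale g b + s"
  have "x \<in> int_mod.span (insert ?w T)" if x: "x \<in> A" for x
  proof -
    obtain k where k: "x - int_scale k b \<in> int_mod.span B"
      using x insert.prems(1) int_mod.span_breakdown_eq by blast
    then have "k \<in> Y" using x by (auto simp: Y_def intro!: bexI[of _ "x - int_scale k b"])
    then obtain c where c: "k = c * g" using g(2) by (metis dvd_def mult.commute)
    have eq: "x - int_scale c ?w = (x - int_scale k b) - int_scale c s"
      unfolding c by (simp add: int_mod.scale_right_distrib)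
    have "x - int_scale c ?w \<in> int_mod.span B"
      unfolding eq by (intro int_mod.span_diff int_mod.span_scale k s(1))
    moreover have "x - int_scale c ?w \<in> A"
      using x insert.prems(2) int_scale_in_add_closed[OF insert.prems(2) s(2)] by (simp add: add_closed_def)
    ultimately have "x - int_scale c ?w \<in> int_mod.span T" using T(3) by blast
    then show ?thesis using int_mod.span_breakdown_eq by blast
  qed
  then show ?case using T s(2) by (intro exI[of _ "insert ?w T"]) auto
qed

text \<open>The span of all \<open>x n\<close> is finitely generated, and its finitely many
  generators already use only an initial segment of the sequence, so the next term is dependent on
  that segment. Applied to the powers of a matrix, this is a monic integral equation.\<close>

lemma finitely_generated_imp_dependence:
  fixes x :: "nat \<Rightarrow> 'a::real_vector"
  assumes "finite F" "range x \<subseteq> int_mod.span F"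
  shows "\<exists>n q. x n = (\<Sum>m<n. int_scale (q m) (x m))"
proof -
  have "int_mod.span (range x) \<subseteq> int_mod.span F"
    using assms(2) by (simp add: int_mod.span_minimal)
  from add_closed_finitely_generated[OF assms(1) this add_closed_int_span]
  obtain T where T: "finite T" "T \<subseteq> int_mod.span (range x)" "int_mod.span (range x) \<subseteq> int_mod.span T"
    by blast
  have mono: "int_mod.span (x ` {..<m}) \<subseteq> int_mod.span (x ` {..<n})" if "m \<le> n" for m n
    using that by (intro int_mod.span_mono) auto
  have "\<exists>n. t \<in> int_mod.span (x ` {..<n})" if "t \<in> int_mod.span (range x)" for t
    using that
  proof (induction rule: int_mod.span_induct_alt)
    case base then show ?case using int_mod.span_zero by blast
  next
    case (step c y t)
    then obtain k n where kn: "y = x k" "t \<in> int_mod.span (x ` {..<n})" by blast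
    have "y \<in> int_mod.span (x ` {..<max (Suc k) n})"
      unfolding kn(1) by (intro int_mod.span_base) auto
    moreover have "t \<in> int_mod.span (x ` {..<max (Suc k) n})"
      using kn(2) mono[of n "max (Suc k) n"] by auto
    ultimately have "int_scale c y + t \<in> int_mod.span (x ` {..<max (Suc k) n})"
      by (intro int_mod.span_add int_mod.span_scale)
    then show ?case ..
  qed
  then obtain n where n: "\<And>t. t \<in> T \<Longrightarrow> t \<in> int_mod.span (x ` {..<n t})" using T(2) by (meson subsetD)
  \<comment> \<open>The inserted 0 gives \<open>Max\<close> a value for empty \<open>T\<close>; then
    \<open>x 0\<close> is the empty sum.\<close>
  define N where "N = Max (insert 0 (n ` T))"
  have "n t \<le> N" if "t \<in> T" for t using that T(1) by (simp add: N_def)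
  then have "T \<subseteq> int_mod.span (x ` {..<N})" using n mono by blast
  then have "int_mod.span T \<subseteq> int_mod.span (x ` {..<N})" by (simp add: int_mod.span_minimal)
  moreover have "x N \<in> int_mod.span (range x)" by (simp add: int_mod.span_base)
  ultimately have "x N \<in> int_mod.span (x ` {..<N})" using T(3) by blast
  then show ?thesis using int_mod.span_image_lessThan by blast
qed

section \<open>Algebraic integers and clearing of denominators\<close>

definition integral_over_int :: "complex \<Rightarrow> bool" where
  "integral_over_int x \<longleftrightarrow> (\<exists>(n::nat) (c::nat \<Rightarrow> int). x ^ n + (\<Sum>m<n. of_int (c m) * x ^ m) = 0)"

text \<open>The module is generated by the monomials in \<open>C\<close> of bounded degree.\<close>

lemma finitely_generated_module_of_integral:
  assumes "finite C" "\<And>c. c \<in> C \<Longrightarrow> integral_over_int c"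
  shows "\<exists>S. finite S \<and> 1 \<in> int_mod.span S \<and> (\<forall>c\<in>C. \<forall>t\<in>int_mod.span S. c * t \<in> int_mod.span S)"
  using assms
proof (induction C)
  case empty
  then show ?case by (intro exI[of _ "{1}"]) (auto intro: int_mod.span_base)
next
  case (insert c C)
  then obtain S where S: "finite S" "1 \<in> int_mod.span S" "\<And>b t. b \<in> C \<Longrightarrow> t \<in> int_mod.span S \<Longrightarrow> b * t \<in> int_mod.span S"
    by auto
  obtain n q where nq: "c ^ n + (\<Sum>m<n. of_int (q m) * c ^ m) = 0"
    using insert.prems[of c] unfolding integral_over_int_def by auto
  \<comment> \<open>Degree 0 would read 1 = 0.\<close>
  then have n: "n > 0" by (cases n) auto
  define S' where "S' = (\<lambda>(i, t). c ^ i * t) ` ({..<n} \<times> S)"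
  have lin: "linear (\<lambda>t. b * t)" for b :: complex
    by (simp add: linear_iff algebra_simps)
  have pow: "c ^ i * t \<in> int_mod.span S'" if "i < n" "t \<in> int_mod.span S" for i t
    by (rule int_span_linear_image[OF lin _ that(2)])
      (use that(1) in \<open>auto simp: S'_def intro!: int_mod.span_base\<close>)
  \<comment> \<open>The monic equation of \<open>c\<close> rewrites the one exponent that leaves the
    allowed range.\<close>
  have "c ^ n * t \<in> int_mod.span S'" if t: "t \<in> int_mod.span S" for t
  proof -
    have "c ^ n = - (\<Sum>m<n. of_int (q m) * c ^ m)" using nq by (simp add: eq_neg_iff_add_eq_0)
    then have "c ^ n * t = - (\<Sum>m<n. int_scale (q m) (c ^ m * t))"
      by (simp add: int_scale_def sum_distrib_right mult.assoc scaleR_conv_of_real)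
    also have "\<dots> \<in> int_mod.span S'"
      by (intro int_mod.span_neg int_mod.span_sum int_mod.span_scale pow t) auto
    finally show ?thesis .
  qed
  then have pow': "c ^ i * t \<in> int_mod.span S'" if "i \<le> n" "t \<in> int_mod.span S" for i t
    using pow that by (cases "i = n") auto
  have "b * t \<in> int_mod.span S'" if b: "b \<in> insert c C" and t: "t \<in> int_mod.span S'" for b t
  proof -
    have "b * (c ^ i * s) \<in> int_mod.span S'" if i: "i < n" and s: "s \<in> S" for i s
    proof (cases "b = c")
      case True
      then show ?thesis using pow'[of "Suc i" s] i s by (simp add: int_mod.span_base mult.assoc)
    next
      case False
      then have "b * s \<in> int_mod.span S" using b s S(3) by (simp add: int_mod.span_base)
      then show ?thesis using pow[OF i] by (metis mult.left_commute)
    qed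
    then have "(\<lambda>t. b * t) ` S' \<subseteq> int_mod.span S'" by (auto simp: S'_def)
    then show ?thesis by (rule int_span_linear_image[OF lin _ t])
  qed
  moreover have "1 \<in> int_mod.span S'" using pow[of 0 1] n S(2) by simp
  moreover have "finite S'" using S(1) by (simp add: S'_def)
  ultimately show ?case by blast
qed

text \<open>Otherwise every initial segment of powers is independent, and \<open>card V + 1\<close>
  powers exceed the dimension of the span of \<open>V\<close>.\<close>

lemma power_in_rat_span_of_lower:
  assumes "finite V" "\<And>k. c ^ k \<in> rat_vs.span V"
  shows "\<exists>n. (c::complex) ^ n \<in> rat_vs.span ((\<lambda>m. c ^ m) ` {..<n})"
proof (rule ccontr)
  assume neg: "\<not> ?thesis"
  have "rat_vs.independent ((\<lambda>m. c ^ m) ` {..<n}) \<and> card ((\<lambda>m. c ^ m) ` {..<n}) = n" for n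
  proof (induction n)
    case 0 then show ?case by (simp add: rat_vs.independent_empty)
  next
    case (Suc n)
    have "c ^ n \<notin> rat_vs.span ((\<lambda>m. c ^ m) ` {..<n})" using neg by blast
    moreover from this have "c ^ n \<notin> (\<lambda>m. c ^ m) ` {..<n}"
      by (rule contrapos_nn) (rule rat_vs.span_base)
    ultimately show ?case
      using Suc by (simp add: lessThan_Suc rat_vs.independent_insertI)
  qed
  from this[of "Suc (card V)"] have ind: "rat_vs.independent ((\<lambda>m. c ^ m) ` {..<Suc (card V)})"
    and card: "card ((\<lambda>m. c ^ m) ` {..<Suc (card V)}) = Suc (card V)" by auto
  have "(\<lambda>m. c ^ m) ` {..<Suc (card V)} \<subseteq> rat_vs.span V" using assms(2) by auto
  from rat_vs.independent_span_bound[OF assms(1) ind this] have "Suc (card V) \<le> card V"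
    unfolding card by (rule conjunct2)
  then show False by simp
qed

text \<open>All multiples of \<open>d\<close> are covered at once, so that the denominators of
  several elements can be multiplied into a common one.\<close>

lemma integral_multiple:
  assumes "finite V" "\<And>k. c ^ k \<in> rat_vs.span V"
  shows "\<exists>d::nat. d > 0 \<and> (\<forall>M. integral_over_int (of_nat (M * d) * c))"
proof -
  obtain n q where q: "c ^ n = (\<Sum>m<n. rat_scale (q m) (c ^ m))"
    using power_in_rat_span_of_lower[OF assms] rat_vs.span_image_lessThan by blast
  obtain d :: nat where d: "d > 0" "\<forall>x\<in>q ` {..<n}. of_nat d * x \<in> \<int>"
    using finite_rat_common_denominator[of "q ` {..<n}"] by auto
  define z where "z m = \<lfloor>of_nat d * q m\<rfloor>" for m
  have z: "rat_of_int (z m) = of_nat d * q m" if "m < n" for m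
    using d(2) that unfolding z_def by (metis Ints_cases floor_of_int imageI lessThan_iff)
  have z': "complex_of_real (real_of_rat (q m)) * of_nat d = of_int (z m)" if "m < n" for m
  proof -
    have "real_of_rat (of_int (z m)) = real_of_rat (of_nat d * q m)" using z[OF that] by simp
    then have "real_of_int (z m) = real d * real_of_rat (q m)" by (simp add: of_rat_mult)
    then show ?thesis by (metis mult.commute of_real_mult of_real_of_int_eq of_real_of_nat_eq)
  qed
  have "integral_over_int (of_nat (M * d) * c)" for M
  proof -
    \<comment> \<open>Multiplication of the relation by the \<open>n\<close>-th power of
      \<open>M d\<close> leaves \<open>n - m\<close> factors \<open>d\<close> at index
      \<open>m\<close>. One of them turns \<open>q m\<close> into the integer \<open>z m\<close>,
      hence the exponent \<open>n - m - 1\<close>.\<close>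
    define e where "e = (\<lambda>m. - (int M ^ (n - m) * int d ^ (n - m - 1) * z m))"
    have summand: "(of_nat (M * d)) ^ n * rat_scale (q m) (c ^ m) = - (of_int (e m) * (of_nat (M * d) * c) ^ m)"
      if m: "m < n" for m
    proof -
      obtain k where k: "n = m + Suc k" using m less_imp_Suc_add by auto
      have "(of_nat (M * d)) ^ n * rat_scale (q m) (c ^ m)
          = of_nat M ^ n * of_nat d ^ (m + k) * (complex_of_real (real_of_rat (q m)) * of_nat d) * c ^ m"
        unfolding k by (simp add: rat_scale_def scaleR_conv_of_real power_mult_distrib power_add)
      also have "\<dots> = - (of_int (e m) * (of_nat (M * d) * c) ^ m)"
        unfolding z'[OF m] e_def unfolding k by (simp add: power_mult_distrib power_add)
      finally show ?thesis .
    qed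
    have "(of_nat (M * d) * c) ^ n = of_nat (M * d) ^ n * (\<Sum>m<n. rat_scale (q m) (c ^ m))"
      unfolding q[symmetric] by (simp add: power_mult_distrib)
    also have "\<dots> = (\<Sum>m<n. - (of_int (e m) * (of_nat (M * d) * c) ^ m))"
      unfolding sum_distrib_left by (intro sum.cong refl summand) simp
    also have "\<dots> = - (\<Sum>m<n. of_int (e m) * (of_nat (M * d) * c) ^ m)"
      by (rule sum_negf)
    finally show ?thesis unfolding integral_over_int_def
      by (intro exI[of _ n] exI[of _ e]) simp
  qed
  then show ?thesis using d(1) by blast
qed

section \<open>Two-by-two complex matrices\<close>

text \<open>The classical adjugate in the form trace minus \<open>A\<close>, from which linearity is
  immediate. On the image of the quaternion algebra it is quaternion conjugation.\<close>

definition adjugate2 :: "complex^2^2 \<Rightarrow> complex^2^2" where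
  "adjugate2 A = mat (A $ 1 $ 1 + A $ 2 $ 2) - A"

lemma adjugate2_mult: "A ** adjugate2 A = mat (det A)" "adjugate2 A ** A = mat (det A)"
  by (simp_all add: adjugate2_def vec_eq_iff forall_2 matrix_matrix_mult_def sum_2 mat_def det_2 algebra_simps)

lemma adjugate2_matrix_mult: "adjugate2 (A ** B) = adjugate2 B ** adjugate2 A"
  by (simp add: adjugate2_def vec_eq_iff forall_2 matrix_matrix_mult_def sum_2 mat_def algebra_simps)

lemma linear_adjugate2: "linear adjugate2"
  by (auto simp: linear_iff adjugate2_def vec_eq_iff forall_2 mat_def algebra_simps)

lemma mat_eq_mat_iff: "mat a = (mat b :: complex^2^2) \<longleftrightarrow> a = b"
  by (auto simp: vec_eq_iff forall_2 mat_def)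

lemma mat_add: "(mat (a + b) :: complex^2^2) = mat a + mat b"
  by (simp add: vec_eq_iff forall_2 mat_def)

lemma mat_mult: "(mat (a * b) :: complex^2^2) = mat a ** mat b"
  by (simp add: vec_eq_iff forall_2 matrix_matrix_mult_def sum_2 mat_def)

lemma mat_commute: "mat a ** A = A ** mat a" for A :: "complex^2^2"
  by (simp add: vec_eq_iff forall_2 matrix_matrix_mult_def sum_2 mat_def)

lemma det_mat_mult: "det (mat a ** A :: complex^2^2) = a\<^sup>2 * det A"
  by (simp add: matrix_matrix_mult_def sum_2 mat_def det_2 power2_eq_square algebra_simps)

lemma mat_mult_left_commute: "A ** (mat a ** B) = mat a ** (A ** B)" for A B :: "complex^2^2"
  by (metis mat_commute matrix_mul_assoc)

lemma mat_mult_mat_mult: "(mat a ** A) ** (mat b ** B) = mat (a * b) ** (A ** B)" for A B :: "complex^2^2"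
  by (simp add: vec_eq_iff forall_2 matrix_matrix_mult_def sum_2 mat_def algebra_simps)

lemma linear_matrix_mult_left: "linear (\<lambda>B. (A :: complex^2^2) ** B)"
  by (auto simp: linear_iff vec_eq_iff forall_2 matrix_matrix_mult_def sum_2 algebra_simps)

lemma linear_matrix_mult_right: "linear (\<lambda>B. B ** (A :: complex^2^2))"
  by (auto simp: linear_iff vec_eq_iff forall_2 matrix_matrix_mult_def sum_2 algebra_simps)

lemma linear_mat_mult: "linear (\<lambda>k. mat k ** (A :: complex^2^2))"
  by (auto simp: linear_iff vec_eq_iff forall_2 matrix_matrix_mult_def sum_2 mat_def algebra_simps)

lemmas matrix_mult_add_left = linear_add[OF linear_matrix_mult_left]
  and matrix_mult_scale_left = linear_scale[OF linear_matrix_mult_left]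
  and matrix_mult_zero_left = linear_0[OF linear_matrix_mult_left]
  and matrix_mult_add_right = linear_add[OF linear_matrix_mult_right]
  and matrix_mult_scale_right = linear_scale[OF linear_matrix_mult_right]
  and matrix_mult_zero_right = linear_0[OF linear_matrix_mult_right]

section \<open>The groups SL(2,C) and PSL(2,C)\<close>

lemma SL2C_simps [simp]:
  "carrier SL2C = {A. det A = 1}" "\<one>\<^bsub>SL2C\<^esub> = mat 1" "A \<otimes>\<^bsub>SL2C\<^esub> B = A ** B"
  by (simp_all add: SL2C_def)

lemma det_adjugate2: "det (adjugate2 A) = det A"
  by (simp add: adjugate2_def det_2 mat_def algebra_simps)

lemma group_SL2C: "group SL2C"
proof (rule groupI)
  fix A assume "A \<in> carrier SL2C"
  then show "\<exists>B\<in>carrier SL2C. B \<otimes>\<^bsub>SL2C\<^esub> A = \<one>\<^bsub>SL2C\<^esub>"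
    by (intro bexI[of _ "adjugate2 A"]) (simp_all add: adjugate2_mult det_adjugate2)
qed (auto simp: det_mul matrix_mul_assoc)

lemma inv_SL2C: "det A = 1 \<Longrightarrow> inv\<^bsub>SL2C\<^esub> A = adjugate2 A"
  by (rule group.inv_equality[OF group_SL2C]) (simp_all add: adjugate2_mult det_adjugate2)

lemma det_minus_mat_1: "det (- mat 1 :: complex^2^2) = 1"
  by (simp add: det_2 mat_def)

lemma minus_matrix_mult: "(- A) ** B = - (A ** B)" "A ** (- B) = - (A ** B)" for A B :: "complex^2^2"
  using linear_neg[OF linear_matrix_mult_right] linear_neg[OF linear_matrix_mult_left[of A]] by auto

lemma normal_center: "{mat 1, - mat 1} \<lhd> SL2C"
proof -
  have adj: "adjugate2 (mat 1) = mat 1" "adjugate2 (- mat 1) = - mat 1"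
    by (simp_all add: adjugate2_def vec_eq_iff forall_2 mat_def)
  have "subgroup {mat 1, - mat 1} SL2C"
    by (rule group.subgroupI[OF group_SL2C])
      (auto simp: det_minus_mat_1 inv_SL2C adj minus_matrix_mult)
  then show ?thesis
    unfolding group.normal_inv_iff[OF group_SL2C]
    by (auto simp: inv_SL2C adjugate2_mult minus_matrix_mult)
qed

lemma group_PSL2C: "group PSL2C"
  unfolding PSL2C_def by (rule normal.factorgroup_is_group[OF normal_center])

lemma group_hom_proj: "group_hom SL2C PSL2C proj_PSL2C"
proof -
  have "proj_PSL2C = (\<lambda>A. {mat 1, - mat 1} #>\<^bsub>SL2C\<^esub> A)"
    by (simp add: fun_eq_iff proj_PSL2C_def)
  then have "proj_PSL2C \<in> hom SL2C PSL2C"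
    unfolding PSL2C_def using normal.r_coset_hom_Mod[OF normal_center] by simp
  then show ?thesis
    by (simp add: group_hom_def group_hom_axioms_def group_SL2C group_PSL2C)
qed

lemma proj_PSL2C_eq: "proj_PSL2C A = {A, - A}"
  by (auto simp: proj_PSL2C_def r_coset_def minus_matrix_mult)

lemma proj_PSL2C_eq_one_iff: "proj_PSL2C A = \<one>\<^bsub>PSL2C\<^esub> \<longleftrightarrow> A = mat 1 \<or> A = - mat 1"
  by (auto simp: PSL2C_def FactGroup_def proj_PSL2C_eq doubleton_eq_iff)

section \<open>Orders in matrix algebras\<close>

text \<open>Follows the recursion of \<open>ring.Span\<close>. The scalars \<open>F\<close> may be
  any set; below they are a field, its integral elements, or a finite set of coefficients.\<close>

fun mat_span :: "complex set \<Rightarrow> (complex^2^2) list \<Rightarrow> (complex^2^2) set" where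
  "mat_span F [] = {0}"
| "mat_span F (u # us) = {mat k ** u + s | k s. k \<in> F \<and> s \<in> mat_span F us}"

lemma mat_spanI: "k \<in> F \<Longrightarrow> s \<in> mat_span F us \<Longrightarrow> mat k ** u + s \<in> mat_span F (u # us)"
  by auto

lemma mat_0_mult: "mat 0 ** A = (0 :: complex^2^2)"
  using linear_0[OF linear_mat_mult] .

lemma mat_of_nat_mult: "mat (of_nat n * k) ** A = of_nat n *\<^sub>R (mat k ** A :: complex^2^2)"
  using linear_scale[OF linear_mat_mult, of "of_nat n" k A] by (simp add: scaleR_conv_of_real)

lemma zero_in_mat_span: "0 \<in> F \<Longrightarrow> 0 \<in> mat_span F us"
proof (induction us)
  case (Cons u us)
  then have "mat 0 ** u + 0 \<in> mat_span F (u # us)" by (intro mat_spanI)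
  then show ?case by (simp only: mat_0_mult add_0)
qed simp

lemma mat_mult_in_mat_span:
  assumes "0 \<in> F" "r \<in> F" "u \<in> set us"
  shows "mat r ** u \<in> mat_span F us"
  using assms(3)
proof (induction us)
  case (Cons v us)
  show ?case
  proof (cases "u = v")
    case True
    have "mat r ** v + 0 \<in> mat_span F (v # us)"
      by (intro mat_spanI assms(2) zero_in_mat_span assms(1))
    then show ?thesis using True by (simp only: add_0_right)
  next
    case False
    then have "mat 0 ** v + mat r ** u \<in> mat_span F (v # us)"
      using Cons assms(1) by (intro mat_spanI) auto
    then show ?thesis by (simp only: mat_0_mult add_0)
  qed
qed simp

lemma mat_span_mono: "F \<subseteq> F' \<Longrightarrow> mat_span F us \<subseteq> mat_span F' us"
  by (induction us) auto

text \<open>Replaces the possibly large ring \<open>R\<close> by finitely many coefficients, to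
  which \<open>finitely_generated_module_of_integral\<close> applies.\<close>

lemma mat_span_finite_support:
  "x \<in> mat_span F us \<Longrightarrow> \<exists>C. finite C \<and> C \<subseteq> F \<and> x \<in> mat_span C us"
proof (induction us arbitrary: x)
  case Nil then show ?case by (intro exI[of _ "{}"]) auto
next
  case (Cons u us)
  then obtain k s where ks: "x = mat k ** u + s" "k \<in> F" "s \<in> mat_span F us" by auto
  then obtain C where "finite C" "C \<subseteq> F" "s \<in> mat_span C us" using Cons.IH by blast
  then show ?case
    using ks mat_span_mono[of C "insert k C" us] by (intro exI[of _ "insert k C"]) auto
qed

lemma mat_span_subset_rat_span:
  assumes "F \<subseteq> rat_vs.span V" "x \<in> mat_span F us" "set us \<subseteq> W"
  shows "x \<in> rat_vs.span ((\<lambda>(v, u). mat v ** u) ` (V \<times> W))"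
  using assms(2,3)
proof (induction us arbitrary: x)
  case Nil then show ?case by (simp add: rat_vs.span_zero)
next
  case (Cons u us)
  then obtain k s where ks: "x = mat k ** u + s" "k \<in> F" "s \<in> mat_span F us" by auto
  have "mat k ** u \<in> rat_vs.span ((\<lambda>(v, u). mat v ** u) ` (V \<times> W))"
    by (rule rat_span_linear_image[OF linear_mat_mult _ subsetD[OF assms(1) ks(2)]])
      (use Cons.prems(2) in \<open>auto intro!: rat_vs.span_base\<close>)
  then show ?case
    unfolding ks(1) using Cons.IH[OF ks(3)] Cons.prems(2) by (intro rat_vs.span_add) auto
qed

text \<open>Each coefficient from \<open>C\<close> is absorbed into \<open>t\<close>, which stays in
  the integer span of \<open>S\<close>; only integer combinations of the products \<open>v u\<close>
  remain.\<close>

lemma mat_mult_mat_span_subset_int_span: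
  assumes C: "\<And>c t. c \<in> C \<Longrightarrow> t \<in> int_mod.span S \<Longrightarrow> c * t \<in> int_mod.span S"
    and "t \<in> int_mod.span S" "x \<in> mat_span C us" "set us \<subseteq> W"
  shows "mat t ** x \<in> int_mod.span ((\<lambda>(v, u). mat v ** u) ` (S \<times> W))"
  using assms(3,4)
proof (induction us arbitrary: x)
  case Nil then show ?case by (simp add: int_mod.span_zero matrix_mult_zero_left)
next
  case (Cons u us)
  then obtain k s where ks: "x = mat k ** u + s" "k \<in> C" "s \<in> mat_span C us" by auto
  have "mat (k * t) ** u \<in> int_mod.span ((\<lambda>(v, u). mat v ** u) ` (S \<times> W))"
    by (rule int_span_linear_image[OF linear_mat_mult _ C[OF ks(2) assms(2)]])
      (use Cons.prems(2) in \<open>auto intro!: int_mod.span_base\<close>)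
  moreover have "mat t ** x = mat (k * t) ** u + mat t ** s"
    unfolding ks(1) by (simp add: matrix_mult_add_left mat_mult mult.commute[of k] matrix_mul_assoc)
  ultimately show ?case
    using Cons.IH[OF ks(3)] Cons.prems(2) by (auto intro: int_mod.span_add)
qed

fun mat_pow :: "complex^2^2 \<Rightarrow> nat \<Rightarrow> complex^2^2" where
  "mat_pow A 0 = mat 1"
| "mat_pow A (Suc n) = A ** mat_pow A n"

lemma mat_pow_add: "mat_pow A (m + n) = mat_pow A m ** mat_pow A n"
  by (induction m) (simp_all add: matrix_mul_assoc)

lemma det_mat_pow: "det (mat_pow A n) = det A ^ n"
  by (induction n) (simp_all add: det_mul)

text \<open>The image under \<rho> of a quaternion algebra \<open>Bs\<close> with an order
  \<open>Os\<close>, reduced to facts about matrices. The same list \<open>Us\<close> generates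
  \<open>Bs\<close> over \<open>K\<close> and \<open>Os\<close> over \<open>R\<close>, and
  \<open>V\<close> witnesses that \<open>K\<close> has finite rational dimension.\<close>

locale matrix_order =
  fixes K R V :: "complex set" and Us :: "(complex^2^2) list" and Bs Os :: "(complex^2^2) set"
  assumes K_add: "add_closed K" and K_one: "1 \<in> K"
    and K_mult: "\<And>a b. a \<in> K \<Longrightarrow> b \<in> K \<Longrightarrow> a * b \<in> K"
    and K_inverse: "\<And>a. a \<in> K \<Longrightarrow> inverse a \<in> K"
    and finite_V: "finite V" and K_span: "K \<subseteq> rat_vs.span V"
    and R_eq: "R = {c \<in> K. integral_over_int c}"
    and Bs_eq: "Bs = mat_span K Us"
    and Bs_mult: "\<And>a b. a \<in> Bs \<Longrightarrow> b \<in> Bs \<Longrightarrow> a ** b \<in> Bs"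
    and mat_in_Bs: "\<And>k. k \<in> K \<Longrightarrow> mat k \<in> Bs"
    and Os_eq: "Os = mat_span R Us"
    and Os_one: "mat 1 \<in> Os" and Os_add: "add_closed Os"
    and Os_mult: "\<And>a b. a \<in> Os \<Longrightarrow> b \<in> Os \<Longrightarrow> a ** b \<in> Os"
begin

lemma zero_R: "0 \<in> R" and one_R: "1 \<in> R"
proof -
  have "integral_over_int 0" "integral_over_int 1"
    unfolding integral_over_int_def
    by (intro exI[of _ 1] exI[of _ "\<lambda>_. 0"] exI[of _ "\<lambda>_. -1"]; simp)+
  then show "0 \<in> R" "1 \<in> R" using K_one add_closed_zero[OF K_add] by (simp_all add: R_eq)
qed

lemma R_mult_generator: "r \<in> R \<Longrightarrow> u \<in> set Us \<Longrightarrow> mat r ** u \<in> Os"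
  unfolding Os_eq using zero_R by (rule mat_mult_in_mat_span)

lemma generators_in_Os: "u \<in> set Us \<Longrightarrow> u \<in> Os"
  using R_mult_generator[OF one_R] by simp

lemma Os_subset_Bs: "Os \<subseteq> Bs"
  unfolding Os_eq Bs_eq by (rule mat_span_mono) (auto simp: R_eq)

section \<open>Denominators and finiteness properties of the order\<close>

lemma R_denominator:
  assumes c: "c \<in> K"
  shows "\<exists>d::nat. d > 0 \<and> (\<forall>M. of_nat (M * d) * c \<in> R)"
proof -
  have "c ^ k \<in> K" for k by (induction k) (auto intro: K_one K_mult c)
  then have "c ^ k \<in> rat_vs.span V" for k using K_span by auto
  from integral_multiple[OF finite_V this]
  obtain d :: nat where d: "d > 0" "\<And>M. integral_over_int (of_nat (M * d) * c)" by auto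
  have "of_nat n * c \<in> K" for n
    using add_closed_of_int_mult[OF K_add c, of "int n"] by simp
  then have "of_nat (M * d) * c \<in> R" for M
    unfolding R_eq using d(2)[of M] by blast
  then show ?thesis using d(1) by blast
qed

lemma Os_denominator:
  assumes "x \<in> Bs"
  shows "\<exists>d::nat. d > 0 \<and> of_nat d *\<^sub>R x \<in> Os"
proof -
  \<comment> \<open>The factor \<open>M\<close> is for the induction: in the product
    \<open>d * e\<close> each denominator plays the part of \<open>M\<close> for the other.\<close>
  have "\<exists>d::nat. d > 0 \<and> (\<forall>M. of_nat (M * d) *\<^sub>R x \<in> mat_span R us)" if "x \<in> mat_span K us" for us
    using that
  proof (induction us arbitrary: x)
    case Nil then show ?case by (intro exI[of _ 1]) auto
  next
    case (Cons u us)
    then obtain k s where ks: "x = mat k ** u + s" "k \<in> K" "s \<in> mat_span K us" by auto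
    from R_denominator[OF ks(2)] obtain d :: nat
      where d: "d > 0" "\<And>M. of_nat (M * d) * k \<in> R" by auto
    from Cons.IH[OF ks(3)] obtain e :: nat
      where e: "e > 0" "\<And>M. of_nat (M * e) *\<^sub>R s \<in> mat_span R us" by auto
    have "of_nat (M * (d * e)) *\<^sub>R x \<in> mat_span R (u # us)" for M
    proof -
      have "of_nat (M * (d * e)) *\<^sub>R x
          = mat (of_nat ((M * e) * d) * k) ** u + of_nat ((M * d) * e) *\<^sub>R s"
        unfolding ks(1) mat_of_nat_mult scaleR_add_right by (simp only: mult_ac)
      then show ?thesis using mat_spanI[OF d(2)[of "M * e"] e(2)[of "M * d"]] by (simp only:)
    qed
    then show ?case using d(1) e(1) by (intro exI[of _ "d * e"]) auto
  qed
  from this[OF assms[unfolded Bs_eq]] obtain d :: nat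
    where d: "d > 0" "\<And>M. of_nat (M * d) *\<^sub>R x \<in> Os" unfolding Os_eq by auto
  show ?thesis using d(1) d(2)[of 1] by auto
qed

lemma Os_mult_nat: "x \<in> Os \<Longrightarrow> of_nat n *\<^sub>R x \<in> Os"
  using Os_add by (rule add_closed_of_nat)

text \<open>If \<open>u\<close> is a generator of the order, \<open>r \<in> R\<close> and \<open>k \<in> K\<close>, then \<open>r k u\<close> is the product of
  the scalar \<open>k\<close>, a multiple of which is in the order, and \<open>r u\<close>, which is in the order.\<close>

lemma R_mult_denominator:
  assumes "y \<in> Bs"
  shows "\<exists>d::nat. d > 0 \<and> (\<forall>r\<in>R. of_nat d *\<^sub>R (mat r ** y) \<in> Os)"
proof -
  have "\<exists>d::nat. d > 0 \<and> (\<forall>r\<in>R. of_nat d *\<^sub>R (mat r ** y) \<in> Os)"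
    if "y \<in> mat_span K us" "set us \<subseteq> set Us" for us
    using that
  proof (induction us arbitrary: y)
    case Nil then show ?case using add_closed_zero[OF Os_add] by (intro exI[of _ 1]) (auto simp: matrix_mult_zero_left)
  next
    case (Cons u us)
    then obtain k s where ks: "y = mat k ** u + s" "k \<in> K" "s \<in> mat_span K us" by auto
    from Os_denominator[OF mat_in_Bs[OF ks(2)]] obtain d :: nat
      where d: "d > 0" "of_nat d *\<^sub>R mat k \<in> Os" by auto
    from Cons.IH[OF ks(3)] Cons.prems(2) obtain e :: nat
      where e: "e > 0" "\<And>r. r \<in> R \<Longrightarrow> of_nat e *\<^sub>R (mat r ** s) \<in> Os" by auto
    have "of_nat (d * e) *\<^sub>R (mat r ** y) \<in> Os" if r: "r \<in> R" for r
    proof -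
      have eq: "of_nat (d * e) *\<^sub>R (mat r ** y)
          = of_nat e *\<^sub>R ((of_nat d *\<^sub>R mat k) ** (mat r ** u)) + of_nat d *\<^sub>R (of_nat e *\<^sub>R (mat r ** s))"
        unfolding ks(1)
        by (simp add: matrix_mult_add_left scaleR_add_right matrix_mult_scale_right mult.commute
            mat_mult_left_commute matrix_mul_assoc mat_commute[of k "mat r"])
      have prod: "(of_nat d *\<^sub>R mat k) ** (mat r ** u) \<in> Os"
        using Cons.prems(2) by (intro Os_mult[OF d(2)] R_mult_generator[OF r]) auto
      show ?thesis
        unfolding eq
        by (intro add_closed_add[OF Os_add] Os_mult_nat[OF prod] Os_mult_nat[OF e(2)[OF r]])
    qed
    then show ?case using d(1) e(1) by (intro exI[of _ "d * e"]) auto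
  qed
  then show ?thesis using assms unfolding Bs_eq by blast
qed

text \<open>Scalars commute with everything, so \<open>p (r u) q\<close> equals
  \<open>r (p u q)\<close>. Each of the finitely many generators \<open>u\<close> has a bound
  uniform in \<open>r\<close>, and the product of these bounds serves the whole order.\<close>

lemma two_sided_denominator:
  assumes p: "p \<in> Bs" and q: "q \<in> Bs"
  shows "\<exists>d::nat. d > 0 \<and> (\<forall>w\<in>Os. of_nat d *\<^sub>R (p ** w ** q) \<in> Os)"
proof -
  have "\<exists>d::nat. d > 0 \<and> (\<forall>w\<in>mat_span R us. of_nat d *\<^sub>R (p ** w ** q) \<in> Os)" if "set us \<subseteq> set Us" for us
    using that
  proof (induction us)
    case Nil
    then show ?case
      using add_closed_zero[OF Os_add]
      by (intro exI[of _ 1]) (auto simp: matrix_mult_zero_left matrix_mult_zero_right)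
  next
    case (Cons u us)
    have "u \<in> Bs" using Cons.prems generators_in_Os Os_subset_Bs by auto
    then have "p ** u ** q \<in> Bs" by (intro Bs_mult p q)
    from R_mult_denominator[OF this] obtain d :: nat
      where d: "d > 0" "\<And>r. r \<in> R \<Longrightarrow> of_nat d *\<^sub>R (mat r ** (p ** u ** q)) \<in> Os" by auto
    from Cons obtain e :: nat
      where e: "e > 0" "\<And>w. w \<in> mat_span R us \<Longrightarrow> of_nat e *\<^sub>R (p ** w ** q) \<in> Os" by auto
    have "of_nat (d * e) *\<^sub>R (p ** w ** q) \<in> Os" if w: "w \<in> mat_span R (u # us)" for w
    proof -
      obtain r s where rs: "w = mat r ** u + s" "r \<in> R" "s \<in> mat_span R us" using w by auto
      have "p ** (mat r ** u) ** q = mat r ** (p ** u ** q)"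
        by (metis mat_mult_left_commute matrix_mul_assoc)
      then have eq: "of_nat (d * e) *\<^sub>R (p ** w ** q)
          = of_nat e *\<^sub>R (of_nat d *\<^sub>R (mat r ** (p ** u ** q))) + of_nat d *\<^sub>R (of_nat e *\<^sub>R (p ** s ** q))"
        unfolding rs(1) by (simp add: matrix_mult_add_left matrix_mult_add_right scaleR_add_right mult.commute)
      show ?thesis
        unfolding eq
        by (intro add_closed_add[OF Os_add] Os_mult_nat[OF d(2)[OF rs(2)]] Os_mult_nat[OF e(2)[OF rs(3)]])
    qed
    then show ?case using d(1) e(1) by (intro exI[of _ "d * e"]) auto
  qed
  from this[of Us] show ?thesis by (simp add: Os_eq)
qed

text \<open>The products of elements of \<open>V\<close> with the generators span a
  finite-dimensional rational space that contains the order.\<close>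

lemma finite_mod_Os: "N > 0 \<Longrightarrow> finite_mod N Os"
proof (rule finite_mod_span[OF _ _ Os_add])
  show "finite ((\<lambda>(v, u). mat v ** u) ` (V \<times> set Us))" using finite_V by simp
  show "Os \<subseteq> rat_vs.span ((\<lambda>(v, u). mat v ** u) ` (V \<times> set Us))"
  proof
    fix x assume "x \<in> Os"
    then have "x \<in> mat_span K Us" using Os_subset_Bs by (auto simp: Bs_eq)
    from mat_span_subset_rat_span[OF K_span this]
    show "x \<in> rat_vs.span ((\<lambda>(v, u). mat v ** u) ` (V \<times> set Us))" by simp
  qed
qed

text \<open>The products \<open>v u\<close>, with \<open>v\<close> from a finite set
  \<open>S\<close> whose integer span is stable under the relevant coefficients, span a group that
  contains 1 and is stable under left multiplication by \<open>x\<close>.\<close>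

lemma mat_pow_finitely_generated:
  assumes x: "x \<in> Os"
  shows "\<exists>F. finite F \<and> range (mat_pow x) \<subseteq> int_mod.span F"
proof -
  have "\<exists>C. finite C \<and> C \<subseteq> R \<and> x ** u \<in> mat_span C Us" if "u \<in> set Us" for u
    using Os_mult[OF x generators_in_Os[OF that]] unfolding Os_eq by (rule mat_span_finite_support)
  then obtain c where c: "\<And>u. u \<in> set Us \<Longrightarrow> finite (c u) \<and> c u \<subseteq> R \<and> x ** u \<in> mat_span (c u) Us"
    by metis
  obtain C1 where C1: "finite C1" "C1 \<subseteq> R" "mat 1 \<in> mat_span C1 Us"
    using mat_span_finite_support[OF Os_one[unfolded Os_eq]] by auto
  \<comment> \<open>\<open>C1\<close> holds coefficients of 1, and \<open>c u\<close> those of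
    \<open>x u\<close>.\<close>
  define C where "C = C1 \<union> (\<Union>u\<in>set Us. c u)"
  have C: "finite C" "C \<subseteq> R" using C1 c by (auto simp: C_def)
  have "integral_over_int r" if "r \<in> C" for r using that C(2) by (auto simp: R_eq)
  from finitely_generated_module_of_integral[OF C(1) this]
  obtain S where S: "finite S" "1 \<in> int_mod.span S"
    "\<And>r t. r \<in> C \<Longrightarrow> t \<in> int_mod.span S \<Longrightarrow> r * t \<in> int_mod.span S" by auto
  define F where "F = (\<lambda>(v, u). mat v ** u) ` (S \<times> set Us)"
  have FI: "mat t ** y \<in> int_mod.span F" if "t \<in> int_mod.span S" "y \<in> mat_span C Us" for t y
    unfolding F_def by (rule mat_mult_mat_span_subset_int_span[OF S(3) that]) auto
  have xF: "x ** f \<in> int_mod.span F" if f: "f \<in> int_mod.span F" for f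
  proof (rule int_span_linear_image[OF linear_matrix_mult_left _ f], rule image_subsetI)
    fix f assume "f \<in> F"
    then obtain v u where vu: "f = mat v ** u" "v \<in> S" "u \<in> set Us" by (auto simp: F_def)
    have "x ** u \<in> mat_span C Us"
      using c[OF vu(3)] mat_span_mono[of "c u" C Us] vu(3) by (auto simp: C_def)
    then show "x ** f \<in> int_mod.span F"
      using FI[OF int_mod.span_base[OF vu(2)]] by (simp add: vu(1) mat_mult_left_commute)
  qed
  have "mat 1 \<in> mat_span C Us" using C1(3) mat_span_mono[of C1 C Us] by (auto simp: C_def)
  from FI[OF S(2) this] have one: "mat 1 \<in> int_mod.span F" by simp
  have "mat_pow x n \<in> int_mod.span F" for n
    by (induction n) (simp_all add: one xF)
  then show ?thesis using S(1) by (intro exI[of _ F]) (auto simp: F_def)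
qed

text \<open>The adjugation is an anti-automorphism, so the adjugate satisfies the same monic integral
  equation as \<open>x\<close>; multiplying by a power of \<open>x\<close> expresses it as an integral polynomial in \<open>x\<close>.\<close>

lemma adjugate2_in_Os:
  assumes x: "x \<in> Os" "det x = 1"
  shows "adjugate2 x \<in> Os"
proof -
  have pow: "mat_pow x n \<in> Os" for n
    by (induction n) (auto intro: Os_one Os_mult x(1))
  obtain F where "finite F" "range (mat_pow x) \<subseteq> int_mod.span F"
    using mat_pow_finitely_generated[OF x(1)] by blast
  from finitely_generated_imp_dependence[OF this]
  obtain n q where nq: "mat_pow x n = (\<Sum>m<n. int_scale (q m) (mat_pow x m))" by blast
  have "n \<noteq> 0"
  proof
    assume "n = 0"
    then have "mat 1 = (0 :: complex^2^2)" using nq by simp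
    then show False by (simp add: vec_eq_iff forall_2 mat_def)
  qed
  then obtain k where k: "n = Suc k" by (cases n) auto
  have cancel: "adjugate2 (mat_pow x m) ** mat_pow x m = mat 1" for m
    by (simp add: adjugate2_mult det_mat_pow x(2))
  \<comment> \<open>With \<open>k = n - 1\<close>, this linear map sends the \<open>n\<close>-th
    power of \<open>x\<close> to \<open>adjugate2 x\<close> and the \<open>m\<close>-th power, for
    \<open>m < n\<close>, to the power \<open>k - m\<close>.\<close>
  let ?L = "\<lambda>A. adjugate2 A ** mat_pow x k"
  have lin: "linear ?L"
    using linear_compose[OF linear_adjugate2 linear_matrix_mult_right[of "mat_pow x k"]] by (simp add: o_def)
  have "?L (mat_pow x n) = adjugate2 x ** (adjugate2 (mat_pow x k) ** mat_pow x k)"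
  proof -
    have "mat_pow x n = mat_pow x k ** x" unfolding k using mat_pow_add[of x k 1] by simp
    then show ?thesis by (simp add: adjugate2_matrix_mult matrix_mul_assoc)
  qed
  then have "adjugate2 x = ?L (mat_pow x n)" by (simp add: cancel)
  also have "\<dots> = (\<Sum>m<n. int_scale (q m) (?L (mat_pow x m)))"
    unfolding nq linear_sum[OF lin] int_scale_def linear_scale[OF lin] ..
  also have "\<dots> = (\<Sum>m<n. int_scale (q m) (mat_pow x (k - m)))"
  proof (intro sum.cong refl arg_cong2[where f = int_scale])
    fix m assume "m \<in> {..<n}"
    then have "k = m + (k - m)" using k by auto
    then have "mat_pow x k = mat_pow x m ** mat_pow x (k - m)" by (metis mat_pow_add)
    then show "?L (mat_pow x m) = mat_pow x (k - m)" by (simp add: matrix_mul_assoc cancel)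
  qed
  also have "\<dots> \<in> Os"
  proof -
    have "(\<Sum>m<j. int_scale (q m) (mat_pow x (k - m))) \<in> Os" for j
      by (induction j) (auto intro: add_closed_zero[OF Os_add] add_closed_add[OF Os_add]
          int_scale_in_add_closed[OF Os_add] pow)
    then show ?thesis .
  qed
  finally show ?thesis .
qed

section \<open>The norm-one group and its extension by a finite group\<close>

definition O1 :: "(complex^2^2) set" where
  "O1 = {x \<in> Os. det x = 1}"

lemma subgroup_O1: "subgroup O1 SL2C"
  by (rule group.subgroupI[OF group_SL2C])
    (use Os_one Os_mult adjugate2_in_Os in \<open>auto simp: O1_def inv_SL2C det_mul det_adjugate2\<close>)

text \<open>The construction works for any finite \<open>W\<close> whose lifts conjugate the order
  with bounded denominators. It is done in SL(2,C) with the full preimage \<open>Q\<close> of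
  \<open>W\<close>, and projected only at the end.\<close>

lemma extension_by_finite_commensurator:
  assumes W: "subgroup W PSL2C" "finite W"
    and denom: "\<And>T. T \<in> \<Union>W \<Longrightarrow> \<exists>d::nat. d > 0 \<and> (\<forall>w\<in>Os. of_nat d *\<^sub>R (T ** w ** adjugate2 T) \<in> Os)"
  shows "\<exists>\<Gamma>\<^sub>0. subgroup \<Gamma>\<^sub>0 PSL2C \<and> commensurable PSL2C \<Gamma>\<^sub>0 (proj_PSL2C ` O1) \<and> W \<subseteq> \<Gamma>\<^sub>0"
proof -
  interpret SL: group SL2C by (rule group_SL2C)
  interpret PSL: group PSL2C by (rule group_PSL2C)
  interpret pr: group_hom SL2C PSL2C proj_PSL2C by (rule group_hom_proj)
  define Q where "Q = \<Union>W"
  have Wproj: "\<exists>T. det T = 1 \<and> Y = {T, - T} \<and> Y = proj_PSL2C T" if "Y \<in> W" for Y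
  proof -
    have "Y \<in> carrier PSL2C" using subgroup.subset[OF W(1)] that by blast
    then obtain T where "det T = 1" "Y = proj_PSL2C T"
      by (auto simp: PSL2C_def FactGroup_def RCOSETS_def proj_PSL2C_def)
    then show ?thesis using proj_PSL2C_eq[of T] by blast
  qed
  have detm: "det (- A) = det A" for A :: "complex^2^2" by (simp add: det_2)
  have projm: "proj_PSL2C (- A) = proj_PSL2C A" for A by (auto simp: proj_PSL2C_eq)
  have Q_iff: "T \<in> Q \<longleftrightarrow> det T = 1 \<and> proj_PSL2C T \<in> W" for T
  proof
    assume "T \<in> Q"
    then obtain Y where Y: "Y \<in> W" "T \<in> Y" by (auto simp: Q_def)
    then obtain T' where T': "det T' = 1" "Y = {T', - T'}" "Y = proj_PSL2C T'" using Wproj by blast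
    then show "det T = 1 \<and> proj_PSL2C T \<in> W" using Y by (auto simp: detm projm)
  next
    assume "det T = 1 \<and> proj_PSL2C T \<in> W"
    then show "T \<in> Q" unfolding Q_def by (intro UnionI[of "proj_PSL2C T"]) (auto simp: proj_PSL2C_eq)
  qed
  have finQ: "finite Q"
    unfolding Q_def using W(2) Wproj by (intro finite_Union) auto
  have Qone: "mat 1 \<in> Q"
    using subgroup.one_closed[OF W(1)] pr.hom_one by (simp add: Q_iff)
  have Qmult: "S ** T \<in> Q" if "S \<in> Q" "T \<in> Q" for S T
    using that subgroup.m_closed[OF W(1)] pr.hom_mult[of S T] by (simp add: Q_iff det_mul)
  have Qinv: "adjugate2 T \<in> Q" if "T \<in> Q" for T
    using that subgroup.m_inv_closed[OF W(1)] pr.hom_inv[of T] by (simp add: Q_iff det_adjugate2 inv_SL2C)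
  have Qdet: "det T = 1" if "T \<in> Q" for T using that by (simp add: Q_iff)
  have adj_adj: "adjugate2 (adjugate2 T) = T" for T
    by (simp add: adjugate2_def vec_eq_iff forall_2 mat_def)
  have canc: "adjugate2 T ** T = mat 1" "T ** adjugate2 T = mat 1" if "det T = 1" for T
    using that by (simp_all add: adjugate2_mult)
  have canc': "adjugate2 T ** (T ** A) = A" "T ** (adjugate2 T ** A) = A" if "det T = 1" for T A :: "complex^2^2"
    using canc[OF that] by (simp_all add: matrix_mul_assoc)

  \<comment> \<open>The condition at \<open>T = 1\<close> places \<open>G\<close> in
    \<open>O1\<close>. As \<open>Q\<close> is closed under products, conjugation by an element of
    \<open>Q\<close> leads from one of these conditions to another.\<close>
  define G where "G = {y. det y = 1 \<and> (\<forall>T\<in>Q. T ** y ** adjugate2 T \<in> Os)}"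
  have GD: "T ** y ** adjugate2 T \<in> Os" if "y \<in> G" "T \<in> Q" for T y
    using that unfolding G_def by blast
  have Gdet: "det y = 1" if "y \<in> G" for y using that by (simp add: G_def)
  have GI: "y \<in> G" if "det y = 1" "\<And>T. T \<in> Q \<Longrightarrow> T ** y ** adjugate2 T \<in> Os" for y
    using that unfolding G_def by blast
  have adj1: "adjugate2 (mat 1) = mat 1"
    by (simp add: adjugate2_def vec_eq_iff forall_2 mat_def)
  have GO1: "G \<subseteq> O1"
  proof
    fix y assume y: "y \<in> G"
    show "y \<in> O1" using GD[OF y Qone] Gdet[OF y] by (simp add: adj1 O1_def)
  qed
  have Gone: "mat 1 \<in> G" by (rule GI) (simp_all add: Os_one Qdet canc)
  have Gmult: "x ** y \<in> G" if "x \<in> G" "y \<in> G" for x y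
  proof -
    have "T ** (x ** y) ** adjugate2 T \<in> Os" if T: "T \<in> Q" for T
    proof -
      have "T ** (x ** y) ** adjugate2 T = (T ** x ** adjugate2 T) ** (T ** y ** adjugate2 T)"
        using canc'[OF Qdet[OF T]] by (simp add: matrix_mul_assoc[symmetric])
      then show ?thesis using Os_mult[OF GD[OF \<open>x \<in> G\<close> T] GD[OF \<open>y \<in> G\<close> T]] by (simp only:)
    qed
    then show ?thesis using Gdet that by (intro GI) (simp_all add: det_mul)
  qed
  have Ginv: "adjugate2 y \<in> G" if "y \<in> G" for y
  proof -
    have "T ** adjugate2 y ** adjugate2 T \<in> Os" if T: "T \<in> Q" for T
    proof -
      have "adjugate2 (T ** y ** adjugate2 T) \<in> Os"
        using Gdet[OF \<open>y \<in> G\<close>] Qdet[OF T]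
        by (intro adjugate2_in_Os GD[OF \<open>y \<in> G\<close> T]) (simp add: det_mul det_adjugate2)
      then show ?thesis by (simp add: adjugate2_matrix_mult adj_adj matrix_mul_assoc)
    qed
    then show ?thesis using Gdet[OF that] by (intro GI) (simp_all add: det_adjugate2)
  qed
  have Gconj: "T ** y ** adjugate2 T \<in> G" if "y \<in> G" "T \<in> Q" for y T
  proof -
    have "S ** (T ** y ** adjugate2 T) ** adjugate2 S = (S ** T) ** y ** adjugate2 (S ** T)" for S
      by (simp add: adjugate2_matrix_mult matrix_mul_assoc)
    then have "S ** (T ** y ** adjugate2 T) ** adjugate2 S \<in> Os" if "S \<in> Q" for S
      using GD[OF \<open>y \<in> G\<close> Qmult[OF \<open>S \<in> Q\<close> \<open>T \<in> Q\<close>]] by (simp only:)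
    then show ?thesis using Qdet[OF that(2)] Gdet[OF that(1)] by (intro GI) (simp_all add: det_mul det_adjugate2)
  qed
  have subG: "subgroup G SL2C"
    by (rule SL.subgroupI) (use Gone Gmult Ginv Gdet in \<open>auto simp: inv_SL2C\<close>)

  define E where "E = {T ** y | T y. T \<in> Q \<and> y \<in> G}"
  have EI: "T ** y \<in> E" if "T \<in> Q" "y \<in> G" for T y
    using that unfolding E_def by blast
  have subE: "subgroup E SL2C"
  proof (rule SL.subgroupI)
    show "E \<subseteq> carrier SL2C" by (auto simp: E_def det_mul Qdet Gdet)
    show "E \<noteq> {}" using Qone Gone by (auto simp: E_def)
  next
    fix a assume "a \<in> E"
    then obtain T y where Ty: "a = T ** y" "T \<in> Q" "y \<in> G" by (auto simp: E_def)
    \<comment> \<open>The inverse of \<open>T y\<close>, with the factor from \<open>Q\<close> moved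
      back to the left at the cost of a conjugation of \<open>G\<close>.\<close>
    have adja: "adjugate2 a = adjugate2 T ** (T ** adjugate2 y ** adjugate2 T)"
      using canc'[OF Qdet[OF Ty(2)]] by (simp add: Ty(1) adjugate2_matrix_mult matrix_mul_assoc[symmetric])
    have "adjugate2 a \<in> E" unfolding adja by (intro EI Gconj Qinv Ginv Ty(2,3))
    then show "inv\<^bsub>SL2C\<^esub> a \<in> E" using Ty Qdet Gdet by (simp add: inv_SL2C det_mul)
  next
    fix a b assume "a \<in> E" "b \<in> E"
    then obtain T y S z where Ty: "a = T ** y" "T \<in> Q" "y \<in> G" "b = S ** z" "S \<in> Q" "z \<in> G"
      by (auto simp: E_def)
    \<comment> \<open>Here too \<open>S\<close> is moved left past \<open>y\<close>, which becomes
      its conjugate by the inverse of \<open>S\<close>.\<close>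
    have ab: "a ** b = (T ** S) ** ((adjugate2 S ** y ** adjugate2 (adjugate2 S)) ** z)"
      using canc'[OF Qdet[OF Ty(5)]] by (simp add: Ty adj_adj matrix_mul_assoc[symmetric])
    have "a ** b \<in> E" unfolding ab by (intro EI Gmult Gconj Qmult Qinv Ty)
    then show "a \<otimes>\<^bsub>SL2C\<^esub> b \<in> E" by simp
  qed

  have EO1: "virtually_within SL2C E O1"
  proof -
    have "\<exists>T y. x = T ** y \<and> T \<in> Q \<and> y \<in> G" if "x \<in> E" for x using that by (auto simp: E_def)
    \<comment> \<open>The factor in the finite set \<open>Q\<close> is the label. For equal labels
      the quotient is a \<open>Q\<close>-conjugate of a quotient in \<open>G\<close>.\<close>
    then obtain t g where tg: "\<And>x. x \<in> E \<Longrightarrow> x = t x ** g x \<and> t x \<in> Q \<and> g x \<in> G" by metis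
    show ?thesis
    proof (rule virtually_withinI[where f = t])
      show "finite (t ` E)" using finQ tg by (meson finite_subset image_subsetI)
      fix x y assume xy: "x \<in> E" "y \<in> E" "t x = t y"
      have xy_eq: "x ** adjugate2 y = t y ** (g x ** adjugate2 (g y)) ** adjugate2 (t y)"
      proof -
        have "x = t y ** g x" "y = t y ** g y" using tg[OF xy(1)] tg[OF xy(2)] xy(3) by simp_all
        then have "x ** adjugate2 y = (t y ** g x) ** adjugate2 (t y ** g y)" by (rule arg_cong2)
        then show ?thesis by (simp only: adjugate2_matrix_mult matrix_mul_assoc)
      qed
      have "x ** adjugate2 y \<in> G"
        unfolding xy_eq using tg[OF xy(1)] tg[OF xy(2)] by (intro Gconj Gmult Ginv) auto
      moreover have "det y = 1" using subgroup.subset[OF subE] xy(2) by auto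
      ultimately show "x \<otimes>\<^bsub>SL2C\<^esub> inv\<^bsub>SL2C\<^esub> y \<in> O1" using GO1 by (auto simp: inv_SL2C)
    qed
  qed

  have O1E: "virtually_within SL2C O1 E"
  proof -
    have "\<exists>d::nat. d > 0 \<and> (\<forall>w\<in>Os. of_nat d *\<^sub>R (T ** w ** adjugate2 T) \<in> Os)" if "T \<in> Q" for T
      using denom that by (simp add: Q_def)
    then obtain d :: "_ \<Rightarrow> nat" where
      d: "\<And>T. T \<in> Q \<Longrightarrow> d T > 0 \<and> (\<forall>w\<in>Os. of_nat (d T) *\<^sub>R (T ** w ** adjugate2 T) \<in> Os)" by metis
    \<comment> \<open>One modulus that clears the denominators of all conjugations by
      \<open>Q\<close>.\<close>
    define N where "N = (\<Prod>T\<in>Q. d T)"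
    have N: "N > 0" using d by (simp add: N_def prod_pos)
    have NQ: "of_nat N *\<^sub>R (T ** w ** adjugate2 T) \<in> Os" if "T \<in> Q" "w \<in> Os" for T w
    proof -
      have "N = (\<Prod>T\<in>Q - {T}. d T) * d T"
        using that(1) finQ by (simp add: N_def prod.remove[of Q T] mult.commute)
      then have eq: "of_nat N *\<^sub>R (T ** w ** adjugate2 T)
          = of_nat (\<Prod>T\<in>Q - {T}. d T) *\<^sub>R (of_nat (d T) *\<^sub>R (T ** w ** adjugate2 T))" by simp
      show ?thesis unfolding eq by (rule Os_mult_nat) (use d[OF that(1)] that(2) in blast)
    qed
    obtain S where S: "finite S" "S \<subseteq> Os" "\<forall>x\<in>Os. \<exists>s\<in>S. \<exists>y\<in>Os. x = s + of_nat N *\<^sub>R y"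
      using finite_mod_Os[OF N] unfolding finite_mod_def by blast
    have "\<exists>s y. s \<in> S \<and> y \<in> Os \<and> x = s + of_nat N *\<^sub>R y" if "x \<in> O1" for x
      using S(3) that by (auto simp: O1_def)
    then obtain s z where sz: "\<And>x. x \<in> O1 \<Longrightarrow> s x \<in> S \<and> z x \<in> Os \<and> x = s x + of_nat N *\<^sub>R z x" by metis
    show ?thesis
    proof (rule virtually_withinI[where f = s])
      show "finite (s ` O1)" using S(1) sz by (meson finite_subset image_subsetI)
      fix x y assume xy: "x \<in> O1" "y \<in> O1" "s x = s y"
      have y: "y \<in> Os" "det y = 1" "det x = 1" using xy by (auto simp: O1_def)
      \<comment> \<open>Equal residues give \<open>x - y = N (z x - z y)\<close>; right
        multiplication by the inverse of \<open>y\<close> turns this into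
        \<open>1 + N w\<close>.\<close>
      define w where "w = (z x - z y) ** adjugate2 y"
      have w: "w \<in> Os"
        unfolding w_def using sz[OF xy(1)] sz[OF xy(2)] Os_add y
        by (intro Os_mult adjugate2_in_Os) (auto simp: add_closed_def)
      have "x = y + of_nat N *\<^sub>R (z x - z y)"
      proof -
        have "x = s y + of_nat N *\<^sub>R z x" "y = s y + of_nat N *\<^sub>R z y"
          using sz[OF xy(1)] sz[OF xy(2)] xy(3) by simp_all
        then have "x - y = of_nat N *\<^sub>R z x - of_nat N *\<^sub>R z y" by (metis add_diff_cancel_left)
        then show ?thesis by (simp add: scaleR_right_diff_distrib diff_eq_eq add.commute)
      qed
      then have "x ** adjugate2 y = (y + of_nat N *\<^sub>R (z x - z y)) ** adjugate2 y" by simp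
      also have "\<dots> = mat 1 + of_nat N *\<^sub>R w"
        unfolding matrix_mult_add_right matrix_mult_scale_right canc(2)[OF y(2)] w_def ..
      finally have eq: "x ** adjugate2 y = mat 1 + of_nat N *\<^sub>R w" .
      have "T ** (x ** adjugate2 y) ** adjugate2 T \<in> Os" if T: "T \<in> Q" for T
      proof -
        have "T ** (x ** adjugate2 y) ** adjugate2 T = mat 1 + of_nat N *\<^sub>R (T ** w ** adjugate2 T)"
          unfolding eq by (simp add: matrix_mult_add_left matrix_mult_add_right matrix_mult_scale_left
              matrix_mult_scale_right canc[OF Qdet[OF T]])
        then show ?thesis using Os_one NQ[OF T w] add_closed_add[OF Os_add] by simp
      qed
      then have "x ** adjugate2 y \<in> G" using y by (intro GI) (simp_all add: det_mul det_adjugate2)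
      from EI[OF Qone this] show "x \<otimes>\<^bsub>SL2C\<^esub> inv\<^bsub>SL2C\<^esub> y \<in> E" using y by (simp add: inv_SL2C)
    qed
  qed

  have sub: "subgroup (proj_PSL2C ` E) PSL2C" "subgroup (proj_PSL2C ` O1) PSL2C"
    using pr.subgroup_img_is_subgroup subE subgroup_O1 by auto
  have "commensurable PSL2C (proj_PSL2C ` E) (proj_PSL2C ` O1)"
    unfolding PSL.commensurable_iff_virtually_within[OF sub]
    using virtually_within_hom_image[OF group_hom_proj] EO1 O1E
      subgroup.subset[OF subE] subgroup.subset[OF subgroup_O1] by blast
  moreover have "W \<subseteq> proj_PSL2C ` E"
  proof
    fix Y assume Y: "Y \<in> W"
    then obtain T where T: "det T = 1" "Y = proj_PSL2C T" using Wproj by blast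
    then have "T \<in> Q" using Y Q_iff by blast
    from EI[OF this Gone] show "Y \<in> proj_PSL2C ` E" using T(2) by simp
  qed
  ultimately show ?thesis using sub(1) by blast
qed

end

section \<open>Matrix representations of quaternion algebras\<close>

text \<open>Shows that \<sigma> composed with the embedding of the rationals from
  \<open>number_field\<close> is the standard inclusion, so that spans over that copy of the
  rationals become \<open>rat_vs\<close> spans.\<close>

lemma additive_multiplicative_of_rat:
  fixes \<phi> :: "rat \<Rightarrow> complex"
  assumes add: "\<And>a b. \<phi> (a + b) = \<phi> a + \<phi> b" and mult: "\<And>a b. \<phi> (a * b) = \<phi> a * \<phi> b"
    and one: "\<phi> 1 = 1"
  shows "\<phi> q = of_real (of_rat q)"
proof -
  have zero: "\<phi> 0 = 0" using add[of 0 0] by simp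
  have minus: "\<phi> (- a) = - \<phi> a" for a using add[of a "- a"] zero by (simp add: eq_neg_iff_add_eq_0 add.commute)
  have nat: "\<phi> (of_nat n) = of_nat n" for n by (induction n) (simp_all add: zero one add)
  have int: "\<phi> (of_int k) = of_int k" for k
  proof (cases k rule: int_cases2)
    case (nonneg n) then show ?thesis using nat[of n] by simp
  next
    case (nonpos n) then show ?thesis using nat[of n] minus[of "of_nat n"] by simp
  qed
  obtain a b where ab: "q = of_int a / of_int b" "b > 0"
    by (metis quotient_of_denom_pos quotient_of_div surj_pair)
  have "\<phi> q * of_int b = of_int a"
    using mult[of q "of_int b"] ab by (simp add: int)
  then have "\<phi> q = of_int a / of_int b" using ab(2) by (simp add: eq_divide_eq)
  then show ?thesis by (simp add: ab(1) of_rat_divide)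
qed

lemma add_pow_class: "add_pow cring_class_ops (k :: int) (z :: 'a::comm_ring_1) = of_int k * z"
proof -
  have nat: "add_pow cring_class_ops (n :: nat) z = of_nat n * z" for n
    by (induction n) (simp_all add: add_pow_def nat_pow_def cring_class_ops_def algebra_simps)
  show ?thesis
  proof (cases k rule: int_cases2)
    case (nonneg n)
    have "add_pow cring_class_ops (int n) z = add_pow cring_class_ops n z"
      unfolding add_pow_def by (rule int_pow_int)
    then show ?thesis unfolding nonneg nat by simp
  next
    case (nonpos n)
    have "add_pow cring_class_ops (- int n) z = \<ominus>\<^bsub>cring_class_ops\<^esub> add_pow cring_class_ops n z"
      unfolding add_pow_def a_inv_def
      by (rule group.int_pow_neg_int[OF abelian_group.a_group[OF ring.is_abelian_group[OF cring.axioms(1)[OF cring_class]]]]) (simp add: carrier_class)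
    then show ?thesis unfolding nonpos nat uminus_class by simp
  qed
qed

text \<open>The homomorphism carries each monic equation to the complex numbers, and its trivial
  kernel carries it back.\<close>

lemma ring_of_integers_iff:
  assumes F: "field F" and \<sigma>: "\<sigma> \<in> ring_hom F (cring_class_ops :: complex ring)"
    and ker: "\<And>y. y \<in> carrier F \<Longrightarrow> \<sigma> y = 0 \<Longrightarrow> y = \<zero>\<^bsub>F\<^esub>"
    and x: "x \<in> carrier F"
  shows "x \<in> ring_of_integers F \<longleftrightarrow> integral_over_int (\<sigma> x)"
proof -
  interpret F: field F by fact
  interpret h: ring_hom_ring F "cring_class_ops :: complex ring" \<sigma>
    using \<sigma> by (intro ring_hom_ringI2 F.ring_axioms cring.axioms(1)[OF cring_class])
  have pow: "\<sigma> (x [^]\<^bsub>F\<^esub> n) = \<sigma> x ^ n" for n :: nat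
    by (induction n) (simp_all add: x class_simps)
  have gh: "group_hom (add_monoid F) (add_monoid (cring_class_ops :: complex ring)) \<sigma>"
    using abelian_group_hom.a_group_hom[OF h.abelian_group_hom_axioms] .
  have ap: "\<sigma> (add_pow F k y) = of_int k * \<sigma> y" if "y \<in> carrier F" for k :: int and y
  proof -
    have "\<sigma> (add_pow F k y) = add_pow cring_class_ops k (\<sigma> y)"
      unfolding add_pow_def by (rule group_hom.hom_int_pow[OF gh]) (simp add: that)
    then show ?thesis by (simp only: add_pow_class)
  qed
  have closed: "add_pow F (c m) (x [^]\<^bsub>F\<^esub> m) \<in> carrier F" for c :: "nat \<Rightarrow> int" and m :: nat
    using x by (intro F.add.int_pow_closed) auto
  have sum: "(\<Oplus>\<^bsub>F\<^esub>m \<in> {..<n}. add_pow F (c m) (x [^]\<^bsub>F\<^esub> m)) \<in> carrier F \<and>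
     \<sigma> (\<Oplus>\<^bsub>F\<^esub>m \<in> {..<n}. add_pow F (c m) (x [^]\<^bsub>F\<^esub> m)) = (\<Sum>m<n. of_int (c m) * \<sigma> x ^ m)"
    for n :: nat and c :: "nat \<Rightarrow> int"
  proof (induction n)
    case 0 then show ?case by (simp add: class_simps)
  next
    case (Suc n)
    then show ?case
      using closed by (simp add: lessThan_Suc F.finsum_insert ap pow x class_simps)
  qed
  have "x [^]\<^bsub>F\<^esub> n \<oplus>\<^bsub>F\<^esub> (\<Oplus>\<^bsub>F\<^esub>m \<in> {..<n}. add_pow F (c m) (x [^]\<^bsub>F\<^esub> m)) = \<zero>\<^bsub>F\<^esub> \<longleftrightarrow>
     \<sigma> x ^ n + (\<Sum>m<n. of_int (c m) * \<sigma> x ^ m) = 0" for n :: nat and c :: "nat \<Rightarrow> int"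
  proof -
    let ?y = "x [^]\<^bsub>F\<^esub> n \<oplus>\<^bsub>F\<^esub> (\<Oplus>\<^bsub>F\<^esub>m \<in> {..<n}. add_pow F (c m) (x [^]\<^bsub>F\<^esub> m))"
    have "?y \<in> carrier F" "\<sigma> ?y = \<sigma> x ^ n + (\<Sum>m<n. of_int (c m) * \<sigma> x ^ m)"
      using sum[of c n] x by (simp_all add: pow class_simps)
    then show ?thesis using ker[of ?y] h.hom_zero by (auto simp: class_simps)
  qed
  then show ?thesis using x by (simp add: ring_of_integers_def integral_over_int_def)
qed

text \<open>The values of \<sigma> on \<open>K\<close> are fixed by \<rho>; its additivity,
  multiplicativity and injectivity there are derived from those of \<rho>.\<close>

locale matrix_representation = ring B for B :: "('b, 'm) ring_scheme" (structure) +
  fixes K :: "'b set" and \<rho> :: "'b \<Rightarrow> complex^2^2" and \<sigma> :: "'b \<Rightarrow> complex"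
  assumes subfield_K: "subfield K B"
    and \<rho>_hom: "\<rho> \<in> ring_hom B M2C" and inj_\<rho>: "inj_on \<rho> (carrier B)"
    and \<rho>_scalar: "\<And>c. c \<in> K \<Longrightarrow> \<rho> c = mat (\<sigma> c)"
begin

lemma K_carrier: "c \<in> K \<Longrightarrow> c \<in> carrier B"
  using subfieldE(3)[OF subfield_K] by blast

lemma K_subring: "subring K B"
  by (rule subfieldE(1)[OF subfield_K])

lemma \<rho>_mult: "x \<in> carrier B \<Longrightarrow> y \<in> carrier B \<Longrightarrow> \<rho> (x \<otimes> y) = \<rho> x ** \<rho> y"
  using ring_hom_mult[OF \<rho>_hom] by (simp add: M2C_def)

lemma \<rho>_add: "x \<in> carrier B \<Longrightarrow> y \<in> carrier B \<Longrightarrow> \<rho> (x \<oplus> y) = \<rho> x + \<rho> y"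
  using ring_hom_add[OF \<rho>_hom] by (simp add: M2C_def)

lemma \<rho>_one: "\<rho> \<one> = mat 1"
  using ring_hom_one[OF \<rho>_hom] by (simp add: M2C_def)

lemma \<rho>_zero: "\<rho> \<zero> = 0"
  using \<rho>_add[of \<zero> \<zero>] by simp

lemma \<rho>_minus: "x \<in> carrier B \<Longrightarrow> \<rho> (\<ominus> x) = - \<rho> x"
  using \<rho>_add[of x "\<ominus> x"] \<rho>_zero group_add_class.minus_unique[of "\<rho> x" "\<rho> (\<ominus> x)"] by (simp add: r_neg)

lemma \<rho>_diff: "x \<in> carrier B \<Longrightarrow> y \<in> carrier B \<Longrightarrow> \<rho> (x \<ominus> y) = \<rho> x - \<rho> y"
  by (simp add: a_minus_def \<rho>_add \<rho>_minus)

lemma \<rho>_eq_iff: "x \<in> carrier B \<Longrightarrow> y \<in> carrier B \<Longrightarrow> \<rho> x = \<rho> y \<longleftrightarrow> x = y"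
  using inj_\<rho> by (auto simp: inj_on_def)

lemma \<sigma>_mult: "a \<in> K \<Longrightarrow> b \<in> K \<Longrightarrow> \<sigma> (a \<otimes> b) = \<sigma> a * \<sigma> b"
  using \<rho>_mult[of a b] subringE(6)[OF K_subring, of a b]
  by (simp add: \<rho>_scalar K_carrier mat_eq_mat_iff flip: mat_mult)

lemma \<sigma>_add: "a \<in> K \<Longrightarrow> b \<in> K \<Longrightarrow> \<sigma> (a \<oplus> b) = \<sigma> a + \<sigma> b"
  using \<rho>_add[of a b] subringE(7)[OF K_subring, of a b]
  by (simp add: \<rho>_scalar K_carrier mat_eq_mat_iff flip: mat_add)

lemma \<sigma>_one: "\<sigma> \<one> = 1"
  using \<rho>_one \<rho>_scalar[OF subringE(3)[OF K_subring]] by (simp add: mat_eq_mat_iff)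

lemma \<sigma>_zero: "\<sigma> \<zero> = 0"
  using \<sigma>_add[of \<zero> \<zero>] subringE(2)[OF K_subring] by simp

lemma \<sigma>_eq_0: "a \<in> K \<Longrightarrow> \<sigma> a = 0 \<Longrightarrow> a = \<zero>"
  using \<rho>_scalar[of a] \<rho>_eq_iff[of a \<zero>] by (simp add: \<rho>_zero K_carrier mat_0)

lemma \<sigma>_diff: "a \<in> K \<Longrightarrow> b \<in> K \<Longrightarrow> \<sigma> (a \<ominus> b) = \<sigma> a - \<sigma> b"
  using \<sigma>_add[of "a \<ominus> b" b] subringE(5,7)[OF K_subring]
  by (simp add: a_minus_def K_carrier a_assoc l_neg)

lemma image_Span:
  assumes F: "F \<subseteq> K" and us: "set us \<subseteq> carrier B"
  shows "\<rho> ` Span F us = mat_span (\<sigma> ` F) (map \<rho> us)"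
proof -
  \<comment> \<open>The inclusion in the carrier joins the induction because \<rho> is additive and
    multiplicative only there.\<close>
  have "Span F us \<subseteq> carrier B \<and> \<rho> ` Span F us = mat_span (\<sigma> ` F) (map \<rho> us)"
    using us
  proof (induction us)
    case Nil then show ?case by (simp add: \<rho>_zero)
  next
    case (Cons u us)
    then have IH: "Span F us \<subseteq> carrier B" "mat_span (\<sigma> ` F) (map \<rho> us) = \<rho> ` Span F us"
      and u: "u \<in> carrier B" by auto
    have mem: "x \<in> Span F (u # us) \<longleftrightarrow> (\<exists>k\<in>F. \<exists>v\<in>Span F us. x = k \<otimes> u \<oplus> v)" for x
      by (simp add: line_extension_mem_iff)
    have val: "\<rho> (k \<otimes> u \<oplus> v) = mat (\<sigma> k) ** \<rho> u + \<rho> v" if "k \<in> F" "v \<in> Span F us" for k v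
    proof -
      have k: "k \<in> K" "v \<in> carrier B" using that F IH(1) by auto
      then show ?thesis using u by (simp add: \<rho>_add \<rho>_mult \<rho>_scalar K_carrier)
    qed
    have "Span F (u # us) \<subseteq> carrier B"
    proof
      fix x assume "x \<in> Span F (u # us)"
      then obtain k v where "k \<in> F" "v \<in> Span F us" "x = k \<otimes> u \<oplus> v" using mem by blast
      then show "x \<in> carrier B" using F IH(1) u K_carrier by (simp add: subset_eq del: Span.simps)
    qed
    moreover have "\<rho> ` Span F (u # us) = {mat k ** \<rho> u + s | k s. k \<in> \<sigma> ` F \<and> s \<in> \<rho> ` Span F us}"
    proof (intro equalityI subsetI)
      fix y assume "y \<in> \<rho> ` Span F (u # us)"
      then obtain x where "x \<in> Span F (u # us)" "y = \<rho> x" by blast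
      then obtain k v where kv: "k \<in> F" "v \<in> Span F us" "y = \<rho> (k \<otimes> u \<oplus> v)" using mem[of x] by blast
      show "y \<in> {mat k ** \<rho> u + s | k s. k \<in> \<sigma> ` F \<and> s \<in> \<rho> ` Span F us}"
        unfolding kv(3) val[OF kv(1,2)] using kv(1,2) by blast
    next
      fix y assume "y \<in> {mat k ** \<rho> u + s | k s. k \<in> \<sigma> ` F \<and> s \<in> \<rho> ` Span F us}"
      then obtain k v where kv: "k \<in> F" "v \<in> Span F us" "y = mat (\<sigma> k) ** \<rho> u + \<rho> v" by blast
      have "k \<otimes> u \<oplus> v \<in> Span F (u # us)" unfolding mem using kv(1,2) by blast
      then show "y \<in> \<rho> ` Span F (u # us)" unfolding kv(3) val[OF kv(1,2), symmetric] by (rule imageI)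
    qed
    ultimately show ?case by (simp only: list.map mat_span.simps(2) IH(2))
  qed
  then show ?thesis ..
qed

lemma finite_rational_span:
  assumes nf: "number_field (B\<lparr>carrier := K\<rparr>)"
  shows "\<exists>V. finite V \<and> \<sigma> ` K \<subseteq> rat_vs.span V"
proof -
  let ?F = "B\<lparr>carrier := K\<rparr>"
  obtain h where F: "field ?F" and h: "h \<in> ring_hom (cring_class_ops :: rat ring) ?F"
    and "ring.finite_dimension ?F (range h) (carrier ?F)"
    using nf unfolding number_field_def by blast
  interpret F: field ?F by fact
  obtain n where n: "F.dimension n (range h) K"
    using \<open>F.finite_dimension (range h) (carrier ?F)\<close> by (auto simp: F.finite_dimension_def)
  have hK: "h q \<in> K" for q
    using ring_hom_closed[OF h, of q] by (simp add: class_simps)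
  have \<sigma>h: "\<sigma> (h q) = of_real (of_rat q)" for q
  proof (rule additive_multiplicative_of_rat)
    show "\<sigma> (h (a + b)) = \<sigma> (h a) + \<sigma> (h b)" for a b
      using ring_hom_add[OF h, of a b] by (simp add: class_simps \<sigma>_add hK)
    show "\<sigma> (h (a * b)) = \<sigma> (h a) * \<sigma> (h b)" for a b
      using ring_hom_mult[OF h, of a b] by (simp add: class_simps \<sigma>_mult hK)
    show "\<sigma> (h 1) = 1"
      using ring_hom_one[OF h] by (simp add: class_simps \<sigma>_one)
  qed
  \<comment> \<open>Induction along the inductive definition of \<open>dimension\<close>: every line
    extension by \<open>v\<close> contributes the one generator \<open>\<sigma> v\<close>.\<close>
  have "E \<subseteq> K \<and> (\<exists>V. finite V \<and> \<sigma> ` E \<subseteq> rat_vs.span V)" if "F.dimension n L E" "L = range h" for n L E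
    using that
  proof (induction rule: F.dimension.induct)
    case (zero_dim L)
    have "\<sigma> ` {\<zero>} \<subseteq> rat_vs.span {}" by (simp add: \<sigma>_zero)
    then show ?case using subringE(2)[OF K_subring] by auto
  next
    case (Suc_dim v E n L)
    then obtain V where V: "E \<subseteq> K" "finite V" "\<sigma> ` E \<subseteq> rat_vs.span V" by blast
    have v: "v \<in> K" using Suc_dim by simp
    have mem: "\<exists>q e. e \<in> E \<and> x = h q \<otimes> v \<oplus> e" if "x \<in> F.line_extension L v E" for x
      using that Suc_dim.prems by (auto simp: F.line_extension_mem_iff)
    have inK: "h q \<otimes> v \<oplus> e \<in> K" if "e \<in> E" for q e
      using that V(1) v hK subringE(6,7)[OF K_subring] by (meson subsetD)
    have "\<sigma> (h q \<otimes> v \<oplus> e) \<in> rat_vs.span (insert (\<sigma> v) V)" if e: "e \<in> E" for q e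
    proof -
      have "\<sigma> (h q \<otimes> v \<oplus> e) = rat_scale q (\<sigma> v) + \<sigma> e"
      proof -
        have "of_real (of_rat q) * \<sigma> v = rat_scale q (\<sigma> v)"
          by (simp add: rat_scale_def scaleR_conv_of_real)
        then show ?thesis
          using e V(1) v hK subringE(6)[OF K_subring] by (simp add: \<sigma>_add \<sigma>_mult \<sigma>h subset_eq)
      qed
      moreover have "\<sigma> e \<in> rat_vs.span (insert (\<sigma> v) V)"
        using V(3) e rat_vs.span_mono[of V "insert (\<sigma> v) V"] by blast
      ultimately show ?thesis
        by (simp add: rat_vs.span_add rat_vs.span_scale rat_vs.span_base)
    qed
    then have "\<sigma> ` F.line_extension L v E \<subseteq> rat_vs.span (insert (\<sigma> v) V)" using mem by fast
    moreover have "F.line_extension L v E \<subseteq> K" using mem inK by fast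
    ultimately show ?case using V(2) by (intro conjI exI[of _ "insert (\<sigma> v) V"]) auto
  qed
  from this[OF n refl] show ?thesis by blast
qed

lemma matrix_order_of_quaternion_order:
  assumes nf: "number_field (B\<lparr>carrier := K\<rparr>)" and ord: "quaternion_order K B Ord"
  shows "\<exists>R V Us. matrix_order (\<sigma> ` K) R V Us (\<rho> ` carrier B) (\<rho> ` Ord)"
proof -
  let ?F = "B\<lparr>carrier := K\<rparr>"
  have F: "field ?F" using nf by (simp add: number_field_def)
  obtain Us where sub: "subring Ord B" and Us: "set Us \<subseteq> carrier B"
    "Ord = Span (ring_of_integers ?F) Us" "Span K Us = carrier B"
    using ord by (auto simp: quaternion_order_def)
  obtain V where V: "finite V" "\<sigma> ` K \<subseteq> rat_vs.span V" using finite_rational_span[OF nf] by blast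
  have RK: "ring_of_integers ?F \<subseteq> K" by (auto simp: ring_of_integers_def)
  have "\<sigma> \<in> ring_hom ?F cring_class_ops"
    by (rule ring_hom_memI) (simp_all add: class_simps \<sigma>_add \<sigma>_mult \<sigma>_one)
  from ring_of_integers_iff[OF F this] 
  have R: "\<sigma> ` ring_of_integers ?F = {c \<in> \<sigma> ` K. integral_over_int c}"
    using RK \<sigma>_eq_0 by auto
  have OrdB: "x \<in> carrier B" if "x \<in> Ord" for x using subringE(1)[OF sub] that by blast
  have "matrix_order (\<sigma> ` K) (\<sigma> ` ring_of_integers ?F) V (map \<rho> Us) (\<rho> ` carrier B) (\<rho> ` Ord)"
  proof
    show "add_closed (\<sigma> ` K)"
      unfolding add_closed_def
    proof (intro conjI ballI)
      show "0 \<in> \<sigma> ` K" using \<sigma>_zero subringE(2)[OF K_subring] by (metis image_eqI)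
      fix x y assume "x \<in> \<sigma> ` K" "y \<in> \<sigma> ` K"
      then obtain a b where ab: "a \<in> K" "b \<in> K" "x = \<sigma> a" "y = \<sigma> b" by blast
      then have "a \<ominus> b \<in> K" using subringE(5,7)[OF K_subring] by (simp add: a_minus_def)
      then show "x - y \<in> \<sigma> ` K" using \<sigma>_diff[of a b] ab by (metis image_eqI)
    qed
    show "1 \<in> \<sigma> ` K" using \<sigma>_one subringE(3)[OF K_subring] by (metis image_eqI)
    show "a * b \<in> \<sigma> ` K" if ab: "a \<in> \<sigma> ` K" "b \<in> \<sigma> ` K" for a b
    proof -
      obtain c d where cd: "c \<in> K" "d \<in> K" "a = \<sigma> c" "b = \<sigma> d" using ab by blast
      then show ?thesis using \<sigma>_mult[of c d] subringE(6)[OF K_subring, of c d] by (metis image_eqI)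
    qed
    show "inverse a \<in> \<sigma> ` K" if a: "a \<in> \<sigma> ` K" for a
    proof -
      obtain c where c: "c \<in> K" "a = \<sigma> c" using a by blast
      show ?thesis
      proof (cases "c = \<zero>")
        case True
        then show ?thesis using a c \<sigma>_zero by simp
      next
        case False
        then have "inv c \<in> K" "c \<otimes> inv c = \<one>"
          using subfield_m_inv[OF subfield_K] c(1) by auto
        then show ?thesis
          using \<sigma>_mult[of c "inv c"] \<sigma>_one c by (metis image_eqI inverse_unique)
      qed
    qed
    show "finite V" "\<sigma> ` K \<subseteq> rat_vs.span V" by fact+
    show "\<sigma> ` ring_of_integers ?F = {c \<in> \<sigma> ` K. integral_over_int c}" by (rule R)
    show "\<rho> ` carrier B = mat_span (\<sigma> ` K) (map \<rho> Us)"
      using image_Span[OF order_refl Us(1)] Us(3) by (simp only:)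
    show "\<rho> ` Ord = mat_span (\<sigma> ` ring_of_integers ?F) (map \<rho> Us)"
      using image_Span[OF RK Us(1)] Us(2) by (simp only:)
    show "a ** b \<in> \<rho> ` carrier B" if ab: "a \<in> \<rho> ` carrier B" "b \<in> \<rho> ` carrier B" for a b
    proof -
      obtain x y where xy: "x \<in> carrier B" "y \<in> carrier B" "a = \<rho> x" "b = \<rho> y" using ab by blast
      then show ?thesis using \<rho>_mult[of x y] by (metis image_eqI m_closed)
    qed
    show "mat k \<in> \<rho> ` carrier B" if k: "k \<in> \<sigma> ` K" for k
    proof -
      obtain c where "c \<in> K" "k = \<sigma> c" using k by blast
      then show ?thesis using \<rho>_scalar[of c] K_carrier[of c] by (metis image_eqI)
    qed
    show "mat 1 \<in> \<rho> ` Ord" using \<rho>_one subringE(3)[OF sub] by (metis image_eqI)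
    show "add_closed (\<rho> ` Ord)"
      unfolding add_closed_def
    proof (intro conjI ballI)
      show "0 \<in> \<rho> ` Ord" using \<rho>_zero subringE(2)[OF sub] by (metis image_eqI)
      fix x y assume "x \<in> \<rho> ` Ord" "y \<in> \<rho> ` Ord"
      then obtain a b where ab: "a \<in> Ord" "b \<in> Ord" "x = \<rho> a" "y = \<rho> b" by blast
      then have "a \<ominus> b \<in> Ord" using subringE(5,7)[OF sub] by (simp add: a_minus_def)
      then show "x - y \<in> \<rho> ` Ord" using \<rho>_diff[of a b] ab OrdB by (metis image_eqI)
    qed
    show "a ** b \<in> \<rho> ` Ord" if ab: "a \<in> \<rho> ` Ord" "b \<in> \<rho> ` Ord" for a b
    proof -
      obtain x y where xy: "x \<in> Ord" "y \<in> Ord" "a = \<rho> x" "b = \<rho> y" using ab by blast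
      then show ?thesis using \<rho>_mult[of x y] OrdB subringE(6)[OF sub, of x y] by (metis image_eqI)
    qed
  qed
  then show ?thesis by blast
qed

end

section \<open>Quaternion conjugation as the adjugate\<close>

lemma anticommuting_adjugate2:
  assumes AC: "A ** C = - (C ** A)" and C: "C ** C = mat b" "b \<noteq> 0"
  shows "adjugate2 A = - A"
proof -
  have tm: "trace (mat b ** A) = b * trace A"
    by (simp add: trace_def sum_2 matrix_matrix_mult_def mat_def algebra_simps)
  have tn: "trace (- D) = - trace D" for D :: "complex^2^2"
    by (simp add: trace_def sum_2)
  \<comment> \<open>Cyclicity of the trace, with the anticommutation, gives that \<open>b\<close>
    times the trace of \<open>A\<close> equals its own negative. A traceless matrix has adjugate
    \<open>- A\<close>.\<close>
  have "C ** A = - (A ** C)" using AC by simp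
  then have "trace (C ** (C ** A)) = - trace (C ** (A ** C))"
    by (simp only: minus_matrix_mult tn)
  also have "trace (C ** (A ** C)) = trace (A ** (C ** C))"
    by (metis trace_mul_sym matrix_mul_assoc)
  also have "A ** (C ** C) = mat b ** A" unfolding C(1) by (rule mat_commute[symmetric])
  finally have "trace (mat b ** A) = - trace (mat b ** A)" unfolding matrix_mul_assoc C(1) .
  then have "b * trace A = - (b * trace A)" unfolding tm .
  then have "trace A = 0" using C(2) by (simp add: equal_neg_zero)
  then show ?thesis by (simp add: adjugate2_def trace_def sum_2 mat_0)
qed

lemma adjugate2_mat: "adjugate2 (mat k) = mat k"
  by (simp add: adjugate2_def vec_eq_iff forall_2 mat_def)

lemma adjugate2_mat_mult: "adjugate2 (mat k ** A) = mat k ** adjugate2 A"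
  by (simp only: adjugate2_matrix_mult adjugate2_mat mat_commute)

context matrix_representation
begin

lemma quaternion_basis_images:
  assumes ij: "quaternion_basis K B i j"
  obtains a b where "a \<in> \<sigma> ` K" "b \<in> \<sigma> ` K" "a \<noteq> 0" "b \<noteq> 0" "\<rho> i ** \<rho> i = mat a" "\<rho> j ** \<rho> j = mat b"
    "\<rho> i ** \<rho> j = - (\<rho> j ** \<rho> i)"
proof -
  have *: "i \<in> carrier B" "j \<in> carrier B" "i \<otimes> i \<in> K" "i \<otimes> i \<noteq> \<zero>" "j \<otimes> j \<in> K" "j \<otimes> j \<noteq> \<zero>"
    "i \<otimes> j = \<ominus> (j \<otimes> i)"
    using ij unfolding quaternion_basis_def by auto
  show ?thesis
  proof (rule that[of "\<sigma> (i \<otimes> i)" "\<sigma> (j \<otimes> j)"])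
    show "\<sigma> (i \<otimes> i) \<in> \<sigma> ` K" "\<sigma> (j \<otimes> j) \<in> \<sigma> ` K" using * by blast+
    show "\<sigma> (i \<otimes> i) \<noteq> 0" "\<sigma> (j \<otimes> j) \<noteq> 0" using \<sigma>_eq_0 * by blast+
    show "\<rho> i ** \<rho> i = mat (\<sigma> (i \<otimes> i))" "\<rho> j ** \<rho> j = mat (\<sigma> (j \<otimes> j))"
      using \<rho>_mult * \<rho>_scalar by metis+
    have "\<rho> (i \<otimes> j) = - \<rho> (j \<otimes> i)" unfolding *(7) using * by (intro \<rho>_minus) simp
    then show "\<rho> i ** \<rho> j = - (\<rho> j ** \<rho> i)" using *(1,2) by (simp only: \<rho>_mult)
  qed
qed

lemma quaternion_basis_adjugate2:
  assumes ij: "quaternion_basis K B i j"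
  shows "adjugate2 (\<rho> i) = - \<rho> i" "adjugate2 (\<rho> j) = - \<rho> j"
    "adjugate2 (\<rho> i ** \<rho> j) = - (\<rho> i ** \<rho> j)"
proof -
  obtain a b where ab: "a \<noteq> 0" "b \<noteq> 0" "\<rho> i ** \<rho> i = mat a" "\<rho> j ** \<rho> j = mat b"
    and anti: "\<rho> i ** \<rho> j = - (\<rho> j ** \<rho> i)"
    using quaternion_basis_images[OF ij] by metis
  show i: "adjugate2 (\<rho> i) = - \<rho> i" by (rule anticommuting_adjugate2[OF anti ab(4,2)])
  show j: "adjugate2 (\<rho> j) = - \<rho> j"
    by (rule anticommuting_adjugate2[OF _ ab(3,1)]) (simp add: anti)
  show "adjugate2 (\<rho> i ** \<rho> j) = - (\<rho> i ** \<rho> j)"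
    unfolding adjugate2_matrix_mult i j minus_matrix_mult minus_minus unfolding anti by simp
qed

lemma quaternion_conjugate_image:
  assumes ij: "quaternion_basis K B i j" and K: "x0 \<in> K" "x1 \<in> K" "x2 \<in> K" "x3 \<in> K"
    and x: "x = x0 \<oplus> x1 \<otimes> i \<oplus> x2 \<otimes> j \<oplus> x3 \<otimes> (i \<otimes> j)"
    and y: "y = x0 \<ominus> x1 \<otimes> i \<ominus> x2 \<otimes> j \<ominus> x3 \<otimes> (i \<otimes> j)"
  shows "y \<in> carrier B" "\<rho> y = adjugate2 (\<rho> x)"
proof -
  have c: "i \<in> carrier B" "j \<in> carrier B" using ij unfolding quaternion_basis_def by auto
  note K' = K[THEN K_carrier]
  show "y \<in> carrier B" unfolding y using c K' by simp
  note lin = linear_add[OF linear_adjugate2] linear_neg[OF linear_adjugate2]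
  have "\<rho> x = mat (\<sigma> x0) + mat (\<sigma> x1) ** \<rho> i + mat (\<sigma> x2) ** \<rho> j + mat (\<sigma> x3) ** (\<rho> i ** \<rho> j)"
    unfolding x using c K' by (simp add: \<rho>_add \<rho>_mult \<rho>_scalar[OF K(1)] \<rho>_scalar[OF K(2)] \<rho>_scalar[OF K(3)] \<rho>_scalar[OF K(4)])
  then have "adjugate2 (\<rho> x) = mat (\<sigma> x0) - mat (\<sigma> x1) ** \<rho> i - mat (\<sigma> x2) ** \<rho> j - mat (\<sigma> x3) ** (\<rho> i ** \<rho> j)"
    by (simp only: lin adjugate2_mat adjugate2_mat_mult quaternion_basis_adjugate2[OF ij] minus_matrix_mult
        diff_conv_add_uminus)
  moreover have "\<rho> y = mat (\<sigma> x0) - mat (\<sigma> x1) ** \<rho> i - mat (\<sigma> x2) ** \<rho> j - mat (\<sigma> x3) ** (\<rho> i ** \<rho> j)"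
    unfolding y using c K' by (simp add: \<rho>_diff \<rho>_mult \<rho>_scalar[OF K(1)] \<rho>_scalar[OF K(2)] \<rho>_scalar[OF K(3)] \<rho>_scalar[OF K(4)])
  ultimately show "\<rho> y = adjugate2 (\<rho> x)" by simp
qed

text \<open>Every candidate for the conjugate, whatever the quaternion basis, is mapped by \<rho> to
  the same adjugate. Injectivity of \<rho> then yields the uniqueness that the definite description
  requires.\<close>

lemma quat_conj_image:
  assumes B: "quaternion_algebra K B" and x: "x \<in> carrier B"
  shows "quat_conj K B x \<in> carrier B" "\<rho> (quat_conj K B x) = adjugate2 (\<rho> x)"
proof -
  define P where "P y \<longleftrightarrow> (\<exists>i j. quaternion_basis K B i j \<and>
        (\<exists>x0 \<in> K. \<exists>x1 \<in> K. \<exists>x2 \<in> K. \<exists>x3 \<in> K.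
           x = x0 \<oplus> x1 \<otimes> i \<oplus> x2 \<otimes> j \<oplus> x3 \<otimes> (i \<otimes> j) \<and>
           y = x0 \<ominus> x1 \<otimes> i \<ominus> x2 \<otimes> j \<ominus> x3 \<otimes> (i \<otimes> j)))" for y
  have P: "y \<in> carrier B \<and> \<rho> y = adjugate2 (\<rho> x)" if Py: "P y" for y
    using Py unfolding P_def
  proof (elim exE conjE bexE)
    fix i j x0 x1 x2 x3
    assume *: "quaternion_basis K B i j" "x0 \<in> K" "x1 \<in> K" "x2 \<in> K" "x3 \<in> K"
      "x = x0 \<oplus> x1 \<otimes> i \<oplus> x2 \<otimes> j \<oplus> x3 \<otimes> (i \<otimes> j)"
      "y = x0 \<ominus> x1 \<otimes> i \<ominus> x2 \<otimes> j \<ominus> x3 \<otimes> (i \<otimes> j)"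
    show ?thesis using quaternion_conjugate_image[OF *] by blast
  qed
  obtain i j where ij: "quaternion_basis K B i j" using B by (auto simp: quaternion_algebra_def)
  have c: "i \<in> carrier B" "j \<in> carrier B" and sp: "Span K [\<one>, i, j, i \<otimes> j] = carrier B"
    using ij unfolding quaternion_basis_def by blast+
  have "x \<in> Span K [\<one>, i, j, i \<otimes> j]" using x sp by blast
  then obtain x0 x1 x2 x3 where K: "x0 \<in> K" "x1 \<in> K" "x2 \<in> K" "x3 \<in> K"
    and xe: "x = x0 \<otimes> \<one> \<oplus> (x1 \<otimes> i \<oplus> (x2 \<otimes> j \<oplus> (x3 \<otimes> (i \<otimes> j) \<oplus> \<zero>)))"
  proof -
    have mem: "\<exists>k\<in>K. \<exists>v\<in>Span K us. z = k \<otimes> u \<oplus> v" if "z \<in> Span K (u # us)" for z u us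
      using that by (simp add: line_extension_mem_iff)
    obtain x0 v0 where 0: "x0 \<in> K" "v0 \<in> Span K [i, j, i \<otimes> j]" "x = x0 \<otimes> \<one> \<oplus> v0"
      using mem[OF \<open>x \<in> Span K [\<one>, i, j, i \<otimes> j]\<close>] by blast
    obtain x1 v1 where 1: "x1 \<in> K" "v1 \<in> Span K [j, i \<otimes> j]" "v0 = x1 \<otimes> i \<oplus> v1"
      using mem[OF 0(2)] by blast
    obtain x2 v2 where 2: "x2 \<in> K" "v2 \<in> Span K [i \<otimes> j]" "v1 = x2 \<otimes> j \<oplus> v2"
      using mem[OF 1(2)] by blast
    obtain x3 v3 where 3: "x3 \<in> K" "v3 \<in> Span K []" "v2 = x3 \<otimes> (i \<otimes> j) \<oplus> v3"
      using mem[OF 2(2)] by blast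
    have "v3 = \<zero>" using 3(2) by simp
    then show ?thesis using that[OF 0(1) 1(1) 2(1) 3(1)] unfolding 0(3) 1(3) 2(3) 3(3) by blast
  qed
  have "x = x0 \<oplus> x1 \<otimes> i \<oplus> x2 \<otimes> j \<oplus> x3 \<otimes> (i \<otimes> j)"
    unfolding xe using K[THEN K_carrier] c by (simp add: a_assoc)
  then have ex: "P (x0 \<ominus> x1 \<otimes> i \<ominus> x2 \<otimes> j \<ominus> x3 \<otimes> (i \<otimes> j))"
    unfolding P_def using ij K by blast
  have "P (THE y. P y)"
  proof (rule theI[where P = P, OF ex])
    fix y assume "P y"
    then show "y = x0 \<ominus> x1 \<otimes> i \<ominus> x2 \<otimes> j \<ominus> x3 \<otimes> (i \<otimes> j)"
      using P ex \<rho>_eq_iff by metis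
  qed
  then have "P (quat_conj K B x)" by (simp only: quat_conj_def P_def)
  then show "quat_conj K B x \<in> carrier B" "\<rho> (quat_conj K B x) = adjugate2 (\<rho> x)" using P by blast+
qed

text \<open>The product of \<open>x\<close> with its conjugate is mapped to
  \<open>A ** adjugate2 A\<close>, the scalar matrix of the determinant.\<close>

lemma norm_one_elements_image:
  assumes B: "quaternion_algebra K B" and O: "Or \<subseteq> carrier B"
  shows "\<rho> ` norm_one_elements K B Or = {A \<in> \<rho> ` Or. det A = 1}"
proof -
  have "quat_norm K B x = \<one> \<longleftrightarrow> det (\<rho> x) = 1" if "x \<in> Or" for x
  proof -
    have x: "x \<in> carrier B" using that O by blast
    have "\<rho> (quat_norm K B x) = mat (det (\<rho> x))"
      unfolding quat_norm_def using x quat_conj_image[OF B x] by (simp add: \<rho>_mult adjugate2_mult)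
    moreover have "quat_norm K B x \<in> carrier B"
      unfolding quat_norm_def using x quat_conj_image[OF B x] by simp
    ultimately show ?thesis using \<rho>_eq_iff[of "quat_norm K B x" \<one>] \<rho>_one
      by (metis one_closed mat_eq_mat_iff)
  qed
  then show ?thesis by (auto simp: norm_one_elements_def)
qed

end

section \<open>The Klein four-group attached to a quaternion basis\<close>

context matrix_order
begin

text \<open>The scalar \<open>c\<close> may lie outside \<open>K\<close>, but conjugation by
  \<open>mat c ** t\<close> sees only its square, the inverse of \<open>det t\<close>. Both outer
  factors can thus be taken in \<open>Bs\<close>, where \<open>two_sided_denominator\<close>
  applies.\<close>

lemma conjugation_denominator:
  assumes t: "t \<in> Bs" "adjugate2 t \<in> Bs" "det t \<in> K" and T: "det (mat c ** t) = 1"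
  shows "\<exists>d::nat. d > 0 \<and> (\<forall>w\<in>Os. of_nat d *\<^sub>R ((mat c ** t) ** w ** adjugate2 (mat c ** t)) \<in> Os)"
proof -
  have c: "c\<^sup>2 = inverse (det t)"
    using T unfolding det_mat_mult by (metis inverse_unique mult.commute)
  have "mat (inverse (det t)) ** adjugate2 t \<in> Bs"
    by (intro Bs_mult mat_in_Bs K_inverse t)
  from two_sided_denominator[OF t(1) this] obtain d :: nat
    where d: "d > 0" "\<And>w. w \<in> Os \<Longrightarrow> of_nat d *\<^sub>R (t ** w ** (mat (inverse (det t)) ** adjugate2 t)) \<in> Os"
    by auto
  have "(mat c ** t) ** w ** adjugate2 (mat c ** t) = t ** w ** (mat (inverse (det t)) ** adjugate2 t)" for w
  proof -
    have "(mat c ** t) ** w ** adjugate2 (mat c ** t) = mat c ** (mat c ** (t ** w ** adjugate2 t))"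
    proof -
      have "(mat c ** t) ** w ** (mat c ** adjugate2 t) = mat c ** ((t ** w) ** (mat c ** adjugate2 t))"
        by (simp only: matrix_mul_assoc)
      also have "\<dots> = mat c ** (mat c ** ((t ** w) ** adjugate2 t))"
        unfolding mat_mult_left_commute[of "t ** w" c "adjugate2 t"] ..
      finally show ?thesis unfolding adjugate2_mat_mult .
    qed
    also have "\<dots> = mat (inverse (det t)) ** (t ** w ** adjugate2 t)"
      unfolding c[symmetric] power2_eq_square mat_mult by (simp only: matrix_mul_assoc)
    finally show ?thesis unfolding mat_mult_left_commute[of "t ** w" _ "adjugate2 t"] .
  qed
  then show ?thesis using d by auto
qed

lemma extension_by_klein_four_group:
  assumes I: "I \<in> Bs" "adjugate2 I = - I" "I ** I = mat a" "a \<in> K" "a \<noteq> 0"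
    and J: "J \<in> Bs" "adjugate2 J = - J" "J ** J = mat b" "b \<in> K" "b \<noteq> 0"
    and anti: "I ** J = - (J ** I)" and IJ: "adjugate2 (I ** J) = - (I ** J)"
  shows "\<exists>\<Gamma>\<^sub>0 W. subgroup \<Gamma>\<^sub>0 PSL2C \<and> commensurable PSL2C \<Gamma>\<^sub>0 (proj_PSL2C ` O1) \<and> W \<subseteq> \<Gamma>\<^sub>0 \<and>
    subgroup W PSL2C \<and> PSL2C\<lparr>carrier := W\<rparr> \<cong> integer_mod_group 2 \<times>\<times> integer_mod_group 2"
proof -
  interpret PSL: group PSL2C by (rule group_PSL2C)
  interpret pr: group_hom SL2C PSL2C proj_PSL2C by (rule group_hom_proj)
  have neg_Bs: "- t \<in> Bs" if "t \<in> Bs" for t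
  proof -
    have "mat (- 1) ** t \<in> Bs"
      using that add_closed_minus[OF K_add K_one] by (intro Bs_mult mat_in_Bs)
    moreover have "mat (- 1) ** t = - t"
      by (simp add: vec_eq_iff forall_2 matrix_matrix_mult_def sum_2 mat_def)
    ultimately show ?thesis by simp
  qed
  \<comment> \<open>The product of \<open>t\<close> with its adjugate \<open>- t\<close> is minus
    its square.\<close>
  have det_K: "det t = - c" if "adjugate2 t = - t" "t ** t = mat c" for t c
  proof -
    have "(mat (det t) :: complex^2^2) = - mat c"
      using adjugate2_mult(1)[of t, symmetric] unfolding that(1) minus_matrix_mult that(2) .
    also have "\<dots> = mat (- c)" by (simp add: vec_eq_iff forall_2 mat_def)
    finally show ?thesis by (simp add: mat_eq_mat_iff)
  qed
  have dI: "det I = - a" "det J = - b" using det_K I J by auto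
  \<comment> \<open>Scaling by the inverse square root brings the nonzero determinant of
    \<open>I\<close> to 1. The square of \<open>P\<close> is then \<open>- mat 1\<close>, trivial in
    PSL(2,C).\<close>
  define c where "c = inverse (csqrt (det I))"
  define e where "e = inverse (csqrt (det J))"
  define P where "P = mat c ** I"
  define S where "S = mat e ** J"
  have det: "det P = 1" "det S = 1"
    using dI I(5) J(5) by (simp_all add: P_def S_def c_def e_def det_mat_mult power_inverse)
  have adj: "adjugate2 P = - P" "adjugate2 S = - S"
    by (simp_all add: P_def S_def adjugate2_mat_mult I J minus_matrix_mult)
  have sq: "P ** P = - mat 1" "S ** S = - mat 1"
    using adjugate2_mult(1)[of P] adjugate2_mult(1)[of S] det by (simp_all add: adj minus_matrix_mult minus_equation_iff)
  have PS_eq: "P ** S = mat (c * e) ** (I ** J)"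
    unfolding P_def S_def by (rule mat_mult_mat_mult)
  have SP_eq: "S ** P = mat (c * e) ** (J ** I)"
    unfolding P_def S_def by (subst mult.commute) (rule mat_mult_mat_mult)
  have PS: "P ** S = - (S ** P)"
    unfolding PS_eq SP_eq anti by (simp add: minus_matrix_mult)
  \<comment> \<open>The lifts anticommute, so their classes commute. That they do not commute makes
    the classes nontrivial and distinct: a lift equal up to sign to 1 or to the other lift would
    commute with it.\<close>
  have noncomm: "P ** S \<noteq> S ** P"
  proof
    assume "P ** S = S ** P"
    then have "P ** S = - (P ** S)" using PS by simp
    then have "P ** S = 0" by (simp add: vec_eq_iff)
    then have "det (P ** S) = 0" by (simp add: det_2)
    then show False using det by (simp add: det_mul)
  qed
  define p where "p = proj_PSL2C P"
  define s where "s = proj_PSL2C S"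
  have projm: "proj_PSL2C (- A) = proj_PSL2C A" for A by (auto simp: proj_PSL2C_eq)
  have one: "proj_PSL2C (mat 1) = \<one>\<^bsub>PSL2C\<^esub>" using pr.hom_one by simp
  have mult: "proj_PSL2C A \<otimes>\<^bsub>PSL2C\<^esub> proj_PSL2C C = proj_PSL2C (A ** C)" if "det A = 1" "det C = 1" for A C
    using pr.hom_mult[of A C] that by simp
  have p: "p \<in> carrier PSL2C" "p \<otimes>\<^bsub>PSL2C\<^esub> p = \<one>\<^bsub>PSL2C\<^esub>" "p \<noteq> \<one>\<^bsub>PSL2C\<^esub>"
    and s: "s \<in> carrier PSL2C" "s \<otimes>\<^bsub>PSL2C\<^esub> s = \<one>\<^bsub>PSL2C\<^esub>" "s \<noteq> \<one>\<^bsub>PSL2C\<^esub>"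
    using det noncomm pr.hom_closed[of P] pr.hom_closed[of S]
    by (auto simp: p_def s_def mult sq projm one proj_PSL2C_eq_one_iff minus_matrix_mult)
  have ps: "p \<otimes>\<^bsub>PSL2C\<^esub> s = s \<otimes>\<^bsub>PSL2C\<^esub> p"
    using det PS by (simp add: p_def s_def mult projm)
  have "p \<noteq> s"
    using noncomm by (auto simp: p_def s_def proj_PSL2C_eq doubleton_eq_iff minus_matrix_mult)
  note V = PSL.klein_four_subgroup[OF p s ps this]
  let ?W = "{\<one>\<^bsub>PSL2C\<^esub>, p, s, p \<otimes>\<^bsub>PSL2C\<^esub> s}"
  \<comment> \<open>Every lift of an element of the four-group is a complex scalar times 1,
    \<open>I\<close>, \<open>J\<close> or \<open>I ** J\<close>; the sign ambiguity goes into the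
    scalar.\<close>
  have elem: "\<exists>c t. T = mat c ** t \<and> t \<in> Bs \<and> adjugate2 t \<in> Bs \<and> det t \<in> K \<and> det (mat c ** t) = 1"
    if T: "T \<in> \<Union>?W" for T
  proof -
    have neg: "- (mat c ** t) = mat (- c) ** t" for c and t :: "complex^2^2"
      by (simp add: vec_eq_iff forall_2 matrix_matrix_mult_def sum_2 mat_def)
    have detm: "det (- A) = det A" for A :: "complex^2^2" by (simp add: det_2)
    have gen: ?thesis
      if tA: "T = A \<or> T = - A" "A = mat c ** t" "t \<in> Bs" "adjugate2 t \<in> Bs" "det t \<in> K" "det A = 1" for A c t
    proof -
      have "det T = 1" using tA(1,6) detm by auto
      moreover obtain c' where "T = mat c' ** t" using tA(1,2) neg by blast
      ultimately show ?thesis using tA(3-5) by blast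
    qed
    have K: "- a \<in> K" "- b \<in> K" using add_closed_minus[OF K_add] I(4) J(4) by auto
    have "?W = {proj_PSL2C (mat 1), proj_PSL2C P, proj_PSL2C S, proj_PSL2C (P ** S)}"
      using det by (simp add: one p_def s_def mult)
    then consider "T = mat 1 \<or> T = - mat 1" | "T = P \<or> T = - P" | "T = S \<or> T = - S" | "T = P ** S \<or> T = - (P ** S)"
      using T by (auto simp: proj_PSL2C_eq)
    then show ?thesis
    proof cases
      case 1
      then show ?thesis
        by (rule gen[of _ 1 "mat 1"]) (simp_all add: adjugate2_mat K_one mat_in_Bs)
    next
      case 2
      then show ?thesis
        by (rule gen[OF _ P_def]) (simp_all add: I neg_Bs dI K det)
    next
      case 3
      then show ?thesis
        by (rule gen[OF _ S_def]) (simp_all add: J neg_Bs dI K det)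
    next
      case 4
      then show ?thesis
        by (rule gen[OF _ PS_eq]) (use K_mult[OF K] in \<open>simp_all add: IJ I J neg_Bs Bs_mult dI det det_mul\<close>)
    qed
  qed
  have "\<exists>d::nat. d > 0 \<and> (\<forall>w\<in>Os. of_nat d *\<^sub>R (T ** w ** adjugate2 T) \<in> Os)" if "T \<in> \<Union>?W" for T
    using elem[OF that] conjugation_denominator by blast
  from extension_by_finite_commensurator[OF V(1) _ this]
  obtain \<Gamma>\<^sub>0 where "subgroup \<Gamma>\<^sub>0 PSL2C" "commensurable PSL2C \<Gamma>\<^sub>0 (proj_PSL2C ` O1)" "?W \<subseteq> \<Gamma>\<^sub>0" by auto
  then show ?thesis using V by blast
qed

lemma subgroup_proj_O1: "subgroup (proj_PSL2C ` O1) PSL2C"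
  using group_hom.subgroup_img_is_subgroup[OF group_hom_proj] subgroup_O1 by blast

end

theorem theorem1p2:
  fixes \<Gamma> :: "(complex^2^2) set set"
  assumes "hyperbolic_3_manifold_group \<Gamma>"
    and "arithmetic_Kleinian_group \<Gamma>"
  shows "\<exists>\<Gamma>\<^sub>0. arithmetic_Kleinian_group \<Gamma>\<^sub>0 \<and>
           commensurable PSL2C \<Gamma> \<Gamma>\<^sub>0 \<and>
           (\<exists>V \<subseteq> \<Gamma>\<^sub>0. subgroup V PSL2C \<and>
              PSL2C\<lparr>carrier := V\<rparr> \<cong> integer_mod_group 2 \<times>\<times> integer_mod_group 2)"
proof -
  interpret PSL: group PSL2C by (rule group_PSL2C)
  obtain K and B :: "(complex^2^2) ring" and \<rho> Or where sub: "subgroup \<Gamma> PSL2C"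
    and data: "arithmetic_data K B \<rho> Or"
    and comm: "commensurable PSL2C \<Gamma> (proj_PSL2C ` \<rho> ` norm_one_elements K B Or)"
    using assms(2) unfolding arithmetic_Kleinian_group_def by blast
  have B: "quaternion_algebra K B" and nf: "number_field (B\<lparr>carrier := K\<rparr>)"
    and hom: "\<rho> \<in> ring_hom B M2C" "inj_on \<rho> (carrier B)"
    and ord: "quaternion_order K B Or"
    using data by (simp_all add: arithmetic_data_def)
  obtain \<sigma> where \<sigma>: "\<And>c. c \<in> K \<Longrightarrow> \<rho> c = mat (\<sigma> c)"
    using data unfolding arithmetic_data_def by blast
  have "ring B" "subfield K B" using B by (simp_all add: quaternion_algebra_def)
  then interpret rep: matrix_representation B K \<rho> \<sigma>
    using hom \<sigma> by (simp add: matrix_representation_def matrix_representation_axioms_def)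
  obtain R V Us where "matrix_order (\<sigma> ` K) R V Us (\<rho> ` carrier B) (\<rho> ` Or)"
    using rep.matrix_order_of_quaternion_order[OF nf ord] by blast
  then interpret mo: matrix_order "\<sigma> ` K" R V Us "\<rho> ` carrier B" "\<rho> ` Or" .
  have "Or \<subseteq> carrier B" using ord subringE(1) by (auto simp: quaternion_order_def)
  then have norm1: "\<rho> ` norm_one_elements K B Or = mo.O1"
    unfolding mo.O1_def by (rule rep.norm_one_elements_image[OF B])
  obtain i j where ij: "quaternion_basis K B i j" using B by (auto simp: quaternion_algebra_def)
  obtain a b where ab: "a \<in> \<sigma> ` K" "b \<in> \<sigma> ` K" "a \<noteq> 0" "b \<noteq> 0" "\<rho> i ** \<rho> i = mat a" "\<rho> j ** \<rho> j = mat b"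
    and anti: "\<rho> i ** \<rho> j = - (\<rho> j ** \<rho> i)"
    by (rule rep.quaternion_basis_images[OF ij])
  have "\<rho> i \<in> \<rho> ` carrier B" "\<rho> j \<in> \<rho> ` carrier B" using ij by (auto simp: quaternion_basis_def)
  note adj = rep.quaternion_basis_adjugate2[OF ij]
  obtain \<Gamma>\<^sub>0 W where G0: "subgroup \<Gamma>\<^sub>0 PSL2C" "commensurable PSL2C \<Gamma>\<^sub>0 (proj_PSL2C ` mo.O1)" "W \<subseteq> \<Gamma>\<^sub>0"
    "subgroup W PSL2C" "PSL2C\<lparr>carrier := W\<rparr> \<cong> integer_mod_group 2 \<times>\<times> integer_mod_group 2"
    using mo.extension_by_klein_four_group[OF \<open>\<rho> i \<in> \<rho> ` carrier B\<close> adj(1) ab(5,1,3)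
        \<open>\<rho> j \<in> \<rho> ` carrier B\<close> adj(2) ab(6,2,4) anti adj(3)] by blast
  \<comment> \<open>The field, algebra, representation and order of \<Gamma> serve for the new group
    as well; \<open>O1\<close> is the intermediate group for both commensurabilities.\<close>
  have "arithmetic_Kleinian_group \<Gamma>\<^sub>0"
    unfolding arithmetic_Kleinian_group_def using G0(1,2) data norm1 by metis
  moreover have "commensurable PSL2C \<Gamma> \<Gamma>\<^sub>0"
    using PSL.commensurable_trans[OF sub mo.subgroup_proj_O1 G0(1)] comm G0(2) norm1
      PSL.commensurable_sym by metis
  ultimately show ?thesis using G0 by blast
qed

end
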